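(* Let $n\ge3$, $0<\lambda\le\Lambda$, $0<R<\infty$, and let $B_R\subset\mathbb{R}^n$ be the ball of radius $R$ centered at the origin. Let $g:[0,\infty)\to[0,\infty)$ be continuous, $G(t)=\int_0^t g(\tau)\,d\tau$, $\varphi_g(s)=\int_0^s e^{G(t)}\,dt$. Fix a sign $\pm$ (the same throughout; for the sign $+$ assume $\widetilde N_+=\frac{\lambda}{\Lambda}(n-1)+1>2$). Let $$f(t)=-\gamma\varphi_g(t)e^{-G(t)}+\psi(t),\quad t\ge0,$$ where $\gamma\ge0$ and $\psi:[0,\infty)\to[0,\infty)$ satisfies: ($\psi_0$) $\psi\in C([0,\infty))$ and $t\mapsto e^{G(\varphi_g^{-1}(t))}\psi(\varphi_g^{-1}(t))$ is locally Lipschitz on $[0,\infty)$; ($\psi_1$) there exists $1<p<p^*_\pm$ such that $\lim_{t\to\infty}\frac{e^{G(t)}\psi(t)}{\varphi_g(t)^p}=C^*$ for some constant $C^*>0$; ($\psi_2$) there exists $c^*\ge0$ such that $c^*-\gamma<\mu_1^\pm$ and $\lim_{t\to0}\frac{e^{G(t)}\psi(t)}{\varphi_g(t)}=c^*$. Then there exists a positive radially symmetric $C^2$ solution $u$ of $$\mathcal{M}^{\pm}_{\lambda,\Lambda}\big(D^2u+g(u)\nabla u\otimes\nabla u\big)+f(u)=0\ \text{ in }B_R,\qquad u=0\ \text{ on }\partial B_R .$$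
   Context: For a symmetric $n\times n$ matrix $M$ with eigenvalues $e_1,\dots,e_n$, $\mathcal{M}^{+}_{\lambda,\Lambda}(M)=\Lambda\sum_{e_i>0}e_i+\lambda\sum_{e_i<0}e_i$ and $\mathcal{M}^{-}_{\lambda,\Lambda}(M)=\lambda\sum_{e_i>0}e_i+\Lambda\sum_{e_i<0}e_i$. $D^2u$ is the Hessian, $\xi\otimes\xi=(\xi_i\xi_j)$. The function $\varphi_g$ is a $C^2$ diffeomorphism of $[0,\infty)$ onto itself. $p^*_\pm$ is the critical exponent for radial solutions in $\mathbb{R}^n$: the number $p^*_\pm>1$ such that, for $p>1$, the equation $\mathcal{M}^\pm_{\lambda,\Lambda}(D^2v)+v^p=0$, $v\ge0$ in $\mathbb{R}^n$ has no non-trivial classical radial solution if $p<p^*_\pm$ and has one if $p\ge p^*_\pm$ (its existence is known; for the sign $+$ under $\widetilde N_+>2$). $\mu_1^\pm$ is the first eigenvalue of $\mathcal{M}^\pm_{\lambda,\Lambda}$ in $B_R$ associated to a positive eigenfunction: the unique number $\mu$ for which there is $\phi>0$ in $B_R$ with $\mathcal{M}^\pm_{\lambda,\Lambda}(D^2\phi)+\mu\phi=0$ in $B_R$ and $\phi=0$ on $\partial B_R$. *)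

theory Defs
  imports "HOL-Analysis.Analysis"
begin

definition gradient :: "(real ^ 'n \<Rightarrow> real) \<Rightarrow> real ^ 'n \<Rightarrow> real ^ 'n" where
  "gradient u x = (\<chi> i. frechet_derivative u (at x) (axis i 1))"

definition hessian :: "(real ^ 'n \<Rightarrow> real) \<Rightarrow> real ^ 'n \<Rightarrow> real ^ 'n ^ 'n" where
  "hessian u x = jacobian (gradient u) (at x)"

text \<open>Only used for open \<open>S\<close>, where \<^const>\<open>differentiable_on\<close> is differentiability at each point.\<close>

definition C2_on :: "(real ^ 'n) set \<Rightarrow> (real ^ 'n \<Rightarrow> real) \<Rightarrow> bool" where
  "C2_on S u \<longleftrightarrow> u differentiable_on S \<and> gradient u differentiable_on S \<and> continuous_on S (hessian u)"

definition radial_on :: "(real ^ 'n) set \<Rightarrow> (real ^ 'n \<Rightarrow> real) \<Rightarrow> bool" where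
  "radial_on S u \<longleftrightarrow> (\<exists>w. \<forall>x\<in>S. u x = w (norm x))"

definition tensor_square :: "real ^ 'n \<Rightarrow> real ^ 'n ^ 'n" where
  "tensor_square \<xi> = (\<chi> i j. \<xi> $ i * \<xi> $ j)"

definition eigenspace :: "real ^ 'n ^ 'n \<Rightarrow> real \<Rightarrow> (real ^ 'n) set" where
  "eigenspace M e = {v. M *v v = e *\<^sub>R v}"

definition eigenvalues :: "real ^ 'n ^ 'n \<Rightarrow> real set" where
  "eigenvalues M = {e. \<exists>v. v \<noteq> 0 \<and> v \<in> eigenspace M e}"

text \<open>The list \<open>e\<^sub>1, \<dots>, e\<^sub>n\<close> of eigenvalues of a symmetric matrix repeats each eigenvalue
  according to its multiplicity, which is the dimension of its eigenspace.\<close>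

definition pos_eigen_sum :: "real ^ 'n ^ 'n \<Rightarrow> real" where
  "pos_eigen_sum M = (\<Sum>e\<in>{e \<in> eigenvalues M. e > 0}. real (dim (eigenspace M e)) * e)"

definition neg_eigen_sum :: "real ^ 'n ^ 'n \<Rightarrow> real" where
  "neg_eigen_sum M = (\<Sum>e\<in>{e \<in> eigenvalues M. e < 0}. real (dim (eigenspace M e)) * e)"

datatype pucci_sign = Plus_Op | Minus_Op

fun pucci :: "pucci_sign \<Rightarrow> real \<Rightarrow> real \<Rightarrow> real ^ 'n ^ 'n \<Rightarrow> real" where
  "pucci Plus_Op lam Lam M = Lam * pos_eigen_sum M + lam * neg_eigen_sum M"
| "pucci Minus_Op lam Lam M = lam * pos_eigen_sum M + Lam * neg_eigen_sum M"

definition entire_radial_solution ::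
    "pucci_sign \<Rightarrow> real \<Rightarrow> real \<Rightarrow> real \<Rightarrow> (real ^ 'n \<Rightarrow> real) \<Rightarrow> bool" where
  "entire_radial_solution s lam Lam p v \<longleftrightarrow>
     C2_on UNIV v \<and> radial_on UNIV v \<and> (\<forall>x. v x \<ge> 0) \<and>
     (\<forall>x. pucci s lam Lam (hessian v x) + v x powr p = 0)"

text \<open>The type argument fixes the dimension \<open>n\<close>. The exponent is characterised by a predicate, which
  determines it uniquely.\<close>

definition is_critical_exponent ::
    "'n::finite itself \<Rightarrow> pucci_sign \<Rightarrow> real \<Rightarrow> real \<Rightarrow> real \<Rightarrow> bool" where
  "is_critical_exponent _ s lam Lam pc \<longleftrightarrow> pc > 1 \<and>
     (\<forall>p. 1 < p \<and> p < pc \<longrightarrow>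
        \<not> (\<exists>v :: real ^ 'n \<Rightarrow> real. entire_radial_solution s lam Lam p v \<and> (\<exists>x. v x \<noteq> 0))) \<and>
     (\<forall>p. 1 < p \<and> pc \<le> p \<longrightarrow>
        (\<exists>v :: real ^ 'n \<Rightarrow> real. entire_radial_solution s lam Lam p v \<and> (\<exists>x. v x \<noteq> 0)))"

definition has_positive_eigenfunction ::
    "'n::finite itself \<Rightarrow> pucci_sign \<Rightarrow> real \<Rightarrow> real \<Rightarrow> real \<Rightarrow> real \<Rightarrow> bool" where
  "has_positive_eigenfunction _ s lam Lam R \<mu> \<longleftrightarrow>
     (\<exists>\<phi> :: real ^ 'n \<Rightarrow> real. C2_on (ball 0 R) \<phi> \<and> continuous_on (cball 0 R) \<phi> \<and>
        (\<forall>x\<in>ball 0 R. \<phi> x > 0) \<and>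
        (\<forall>x\<in>ball 0 R. pucci s lam Lam (hessian \<phi> x) + \<mu> * \<phi> x = 0) \<and>
        (\<forall>x\<in>sphere 0 R. \<phi> x = 0))"

definition is_first_eigenvalue ::
    "'n::finite itself \<Rightarrow> pucci_sign \<Rightarrow> real \<Rightarrow> real \<Rightarrow> real \<Rightarrow> real \<Rightarrow> bool" where
  "is_first_eigenvalue N s lam Lam R \<mu> \<longleftrightarrow> has_positive_eigenfunction N s lam Lam R \<mu> \<and>
     (\<forall>\<nu>. has_positive_eigenfunction N s lam Lam R \<nu> \<longrightarrow> \<nu> = \<mu>)"

definition primitive :: "(real \<Rightarrow> real) \<Rightarrow> real \<Rightarrow> real" where
  "primitive g t = integral {0..t} g"

definition phi :: "(real \<Rightarrow> real) \<Rightarrow> real \<Rightarrow> real" where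
  "phi g s = integral {0..s} (\<lambda>t. exp (primitive g t))"

text \<open>Inverse of \<^term>\<open>phi g\<close> as a bijection of \<open>[0, \<infinity>)\<close>.\<close>

definition phi_inv :: "(real \<Rightarrow> real) \<Rightarrow> real \<Rightarrow> real" where
  "phi_inv g = the_inv_into {0..} (phi g)"

text \<open>The library notion is for time-dependent maps; here the time parameter is a dummy.\<close>

definition locally_lipschitz_on :: "real set \<Rightarrow> (real \<Rightarrow> real) \<Rightarrow> bool" where
  "locally_lipschitz_on X h \<longleftrightarrow> local_lipschitz (UNIV :: real set) X (\<lambda>_. h)"

end

theory Submission
  imports Defs
begin

text \<open>The substitution \<open>v = \<phi>\<^sub>g(u)\<close> removes the gradient term and turns the problem into
  \<open>M(D\<^sup>2 v) + F(v) = 0\<close> with \<open>F(t) = e\<^bsup>G\<^esup> \<psi> - \<gamma> t\<close>, evaluated at \<open>\<phi>\<^sub>g\<^bsup>-1\<^esup>(t)\<close>. Radial solutions are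
  found by shooting on \<open>\<alpha> = v(0)\<close>. For small \<open>\<alpha>\<close> the solution stays positive on \<open>[0, R]\<close>, because
  after division by \<open>\<alpha>\<close> it is close to the solution of the linear problem with constant below the
  first eigenvalue. For large \<open>\<alpha>\<close> it changes sign before \<open>R\<close>, because the blow-up limit solves
  \<open>M(D\<^sup>2 w) + C\<^sup>* w\<^sup>p = 0\<close>, which has no entire nonnegative solution for subcritical \<open>p\<close>. The minimum of
  \<open>v\<close> over \<open>[0, R]\<close> depends continuously on \<open>\<alpha>\<close>, so it vanishes for some \<open>\<alpha>\<close>; an interior zero would be
  a double zero, which uniqueness forbids, so the only zero is \<open>R\<close>. The bound \<open>F(t) \<ge> - \<gamma> t\<close> limits
  the growth of \<open>v\<close> in terms of \<open>\<alpha>\<close> and so permits a truncation of \<open>F\<close> that makes all the initial value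
  problems globally Lipschitz.\<close>

section \<open>The radial initial value problem\<close>

text \<open>The Hessian of a radial v has the simple eigenvalue v'' and the eigenvalue v'/r of
  multiplicity n - 1. Either Pucci operator thus becomes m(v'') + (n - 1) m(v'/r) with one
  increasing piecewise linear m, and inverting m gives v'' explicitly. Two obstacles shape the rest.
  The equation is singular at r = 0 and m has a kink, so the analysis rests on Lipschitz estimates:
  existence, continuous dependence and both limit passages all come from the single estimate
  \<open>T_diff\<close>. Moreover, the truncation level and the range of shooting parameters depend
  on each other. The level is therefore taken proportional to the initial value, which makes it a
  fixed number after the blow-up. The critical exponent and the first eigenvalue enter only through
  their defining properties: a dilation turns an unwanted ODE solution into a forbidden entire
  solution or a forbidden eigenfunction.\<close>

definition two_slope :: "real \<Rightarrow> real \<Rightarrow> real \<Rightarrow> real" where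
  "two_slope a b x = a * max x 0 + b * min x 0"

lemma two_slope_scale: "c \<ge> 0 \<Longrightarrow> two_slope a b (c * x) = c * two_slope a b x"
  by (cases "c = 0"; cases "x = 0"; cases "x > 0")
    (auto simp: two_slope_def max_def min_def mult_le_0_iff zero_le_mult_iff)

lemma two_slope_inverse:
  assumes "a > 0" "b > 0"
  shows "two_slope a b (two_slope (1 / a) (1 / b) x) = x"
  using assms by (cases "x > 0") (auto simp: two_slope_def max_def min_def mult_le_0_iff divide_le_0_iff zero_le_divide_iff)

lemma two_slope_diff:
  assumes "a \<ge> 0" "b \<ge> 0" "x \<le> y"
  shows "0 \<le> two_slope a b y - two_slope a b x"
    and "two_slope a b y - two_slope a b x \<le> max a b * (y - x)"
proof -
  have mono: "max x 0 \<le> max y 0" "min x 0 \<le> min y 0" using assms by auto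
  have *: "two_slope a b y - two_slope a b x = a * (max y 0 - max x 0) + b * (min y 0 - min x 0)"
    by (simp add: two_slope_def algebra_simps)
  show "0 \<le> two_slope a b y - two_slope a b x"
    unfolding * using assms mono by (intro add_nonneg_nonneg mult_nonneg_nonneg) auto
  have "a * (max y 0 - max x 0) + b * (min y 0 - min x 0)
      \<le> max a b * (max y 0 - max x 0) + max a b * (min y 0 - min x 0)"
    using mono by (intro add_mono mult_right_mono) auto
  also have "\<dots> = max a b * ((max y 0 + min y 0) - (max x 0 + min x 0))"
    by (simp add: algebra_simps)
  also have "\<dots> = max a b * (y - x)" by (simp add: max_def min_def)
  finally show "two_slope a b y - two_slope a b x \<le> max a b * (y - x)" unfolding * .
qed

lemma two_slope_sgn:
  assumes "a > 0" "b > 0"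
  shows "two_slope a b x \<ge> 0 \<longleftrightarrow> x \<ge> 0" "two_slope a b x \<le> 0 \<longleftrightarrow> x \<le> 0"
  using assms by (auto simp: two_slope_def max_def min_def mult_le_0_iff zero_le_mult_iff)

section \<open>Radial integrals rescaled to the unit interval\<close>

lemma has_integral_power_01: "((\<lambda>t. t ^ k) has_integral (1 / (real k + 1))) {0..1::real}"
proof -
  have "((\<lambda>t::real. t ^ Suc k / (real k + 1)) has_real_derivative t ^ k) (at t within {0..1})" for t
    using DERIV_cdivide[OF DERIV_pow[of "Suc k" t "{0..1}"], of "real k + 1"]
    by (simp add: add.commute del: power_Suc)
  then have "((\<lambda>t. t ^ k) has_integral (1 ^ Suc k / (real k + 1) - 0 ^ Suc k / (real k + 1))) {0..1::real}"
    by (intro fundamental_theorem_of_calculus)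
       (auto simp: has_real_derivative_iff_has_vector_derivative)
  then show ?thesis by simp
qed

text \<open>The Gaussian weight is adapted to \<open>radial_v\<close>: its radial integral is
  elementary and returns at most the weight divided by 2 L. A large L makes the influence of z on v
  small.\<close>

lemma has_integral_gauss_01:
  fixes L s :: real
  assumes "L > 0"
  shows "((\<lambda>t. s\<^sup>2 * (t * exp (L * (s * t)\<^sup>2))) has_integral ((exp (L * s\<^sup>2) - 1) / (2 * L))) {0..1::real}"
proof -
  have "((\<lambda>t. exp (L * (s * t)\<^sup>2) / (2 * L)) has_real_derivative s\<^sup>2 * (t * exp (L * (s * t)\<^sup>2))) (at t within {0..1})" for t
    using assms by (auto intro!: derivative_eq_intros simp: power2_eq_square field_simps)
  then have "((\<lambda>t. s\<^sup>2 * (t * exp (L * (s * t)\<^sup>2))) has_integral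
      (exp (L * (s * 1)\<^sup>2) / (2 * L) - exp (L * (s * 0)\<^sup>2) / (2 * L))) {0..1::real}"
    by (intro fundamental_theorem_of_calculus)
       (auto simp: has_real_derivative_iff_has_vector_derivative)
  then show ?thesis by (simp add: diff_divide_distrib)
qed

lemma continuous_on_dilation_integral:
  fixes X :: "real \<Rightarrow> real"
  assumes "continuous_on UNIV X"
  shows "continuous_on UNIV (\<lambda>r. integral {0..1} (\<lambda>t. t ^ k * X (r * t)))"
proof -
  have "continuous_on (UNIV \<times> cbox 0 1) (\<lambda>(r, t). t ^ k * X (r * t))"
    unfolding case_prod_beta
    by (intro continuous_intros continuous_on_compose2[OF assms]) auto
  from integral_continuous_on_param[OF this] show ?thesis by simp
qed

text \<open>The substitution q = r t turns the differentiated function into the integral of q^k X(q)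
  from 0 to r. The dilated form makes sense for every real r, including 0.\<close>

lemma has_real_derivative_dilation_integral:
  fixes X :: "real \<Rightarrow> real"
  assumes cont: "continuous_on UNIV X"
  shows "((\<lambda>r. r ^ Suc k * integral {0..1} (\<lambda>t. t ^ k * X (r * t))) has_real_derivative r ^ k * X r) (at r)"
proof -
  \<comment> \<open>The interval is symmetric about 0 and has \<open>r\<close> in its interior, so
    it contains the segment from 0 to \<open>r\<close> and gives a two-sided derivative at
    \<open>r\<close>, whatever the sign of \<open>r\<close>.\<close>
  define B where "B = \<bar>r\<bar> + 1"
  have "continuous_on {-B..B} (\<lambda>s. s ^ k * X s)"
    by (intro continuous_intros continuous_on_subset[OF cont]) auto
  then obtain \<Phi> where \<Phi>: "\<And>s. s \<in> {-B..B} \<Longrightarrow>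
      (\<Phi> has_vector_derivative (s ^ k * X s)) (at s within {-B..B})"
    using antiderivative_continuous by blast
  have eq: "q ^ Suc k * integral {0..1} (\<lambda>t. t ^ k * X (q * t)) = \<Phi> q - \<Phi> 0" if q: "q \<in> {-B<..<B}" for q
  proof -
    have sub: "q * t \<in> {-B..B}" if "t \<in> {0..1}" for t
    proof -
      have "\<bar>q * t\<bar> \<le> \<bar>q\<bar> * 1" unfolding abs_mult using that by (intro mult_left_mono) auto
      then show ?thesis using q by auto
    qed
    have "((\<lambda>t. \<Phi> (q * t)) has_real_derivative (q * t) ^ k * X (q * t) * q) (at t within {0..1})"
      if "t \<in> {0..1}" for t
    proof (rule DERIV_image_chain[where g = "\<lambda>t. q * t" and f = \<Phi>, unfolded o_def])
      show "((\<lambda>t. q * t) has_real_derivative q) (at t within {0..1})"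
        by (auto intro!: derivative_eq_intros)
      have "(\<lambda>t. q * t) ` {0..1} \<subseteq> {-B..B}" using sub by auto
      then show "(\<Phi> has_real_derivative (q * t) ^ k * X (q * t)) (at (q * t) within (\<lambda>t. q * t) ` {0..1})"
        using \<Phi>[OF sub[OF that]]
        by (simp add: has_real_derivative_iff_has_vector_derivative has_vector_derivative_within_subset)
    qed
    then have "((\<lambda>t. (q * t) ^ k * X (q * t) * q) has_integral (\<Phi> (q * 1) - \<Phi> (q * 0))) {0..1}"
      by (intro fundamental_theorem_of_calculus)
        (auto simp: has_real_derivative_iff_has_vector_derivative)
    moreover have "(\<lambda>t. (q * t) ^ k * X (q * t) * q) = (\<lambda>t. q ^ Suc k * (t ^ k * X (q * t)))"
      by (simp add: power_mult_distrib algebra_simps)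
    ultimately show ?thesis by (simp add: integral_unique flip: integral_mult_right)
  qed
  have "(\<Phi> has_real_derivative r ^ k * X r) (at r)"
    using \<Phi>[of r] by (auto simp: has_real_derivative_iff_has_vector_derivative B_def
        at_within_Icc_at abs_if split: if_splits)
  then have "((\<lambda>q. \<Phi> q - \<Phi> 0) has_real_derivative r ^ k * X r) (at r)"
    by (auto intro!: derivative_eq_intros)
  moreover have "open {-B<..<B}" "r \<in> {-B<..<B}" by (auto simp: B_def abs_if)
  ultimately show ?thesis
    using eq by (rule_tac DERIV_cong_ev[THEN iffD1, rotated -1]) 
      (auto simp: eventually_nhds intro!: exI[of _ "{-B<..<B}"])
qed

text \<open>Here \<nu> plays the part of the multiplicity n - 1. \<open>N\<close> bounds the
  Lipschitz constant of \<open>H\<close> in its first argument, which can exceed \<nu> when the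
  slopes differ; it is a natural number so that it can serve as an exponent in
  \<open>T\<close>.\<close>

locale radial_pucci =
  fixes a b \<nu> :: real and N :: nat
  assumes a_pos: "a > 0" and b_pos: "b > 0" and \<nu>_nonneg: "\<nu> \<ge> 0"
    and N_ge: "\<nu> * (max a b / min a b) \<le> real N"
begin

abbreviation m :: "real \<Rightarrow> real" where "m \<equiv> two_slope a b"
abbreviation m_inv :: "real \<Rightarrow> real" where "m_inv \<equiv> two_slope (1 / a) (1 / b)"

definition ell :: real where "ell = min a b"

text \<open>The equation m(w) + \<nu> m(z) + c = 0 solved for w. With z = v'/r and c = F(v) the
  value is v''.\<close>

definition H :: "real \<Rightarrow> real \<Rightarrow> real" where
  "H z c = m_inv (- \<nu> * m z - c)"

text \<open>A radial function with profile \<^term>\<open>v\<close> is encoded by \<open>z(r) = v'(r) / r\<close>. The radial equation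
  \<open>v'' = H(z, F(v))\<close>, that is \<open>r z' = H(z, F(v)) - z\<close>, reads
  \<open>(r\<^bsup>N+1\<^esup> z)' = r\<^sup>N (H(z, F(v)) + N z)\<close>; integrated from \<open>0\<close> and rescaled to \<open>[0, 1]\<close> this is
  \<open>z = T(z)\<close>, in which the singularity at \<open>r = 0\<close> has disappeared.\<close>

definition radial_v :: "real \<Rightarrow> (real \<Rightarrow> real) \<Rightarrow> real \<Rightarrow> real" where
  "radial_v \<alpha> z r = \<alpha> + r\<^sup>2 * integral {0..1} (\<lambda>t. t * z (r * t))"

definition integrand :: "(real \<Rightarrow> real) \<Rightarrow> real \<Rightarrow> (real \<Rightarrow> real) \<Rightarrow> real \<Rightarrow> real" where
  "integrand F \<alpha> z q = H (z q) (F (radial_v \<alpha> z q)) + real N * z q"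

definition T :: "(real \<Rightarrow> real) \<Rightarrow> real \<Rightarrow> (real \<Rightarrow> real) \<Rightarrow> real \<Rightarrow> real" where
  "T F \<alpha> z r = integral {0..1} (\<lambda>t. t ^ N * integrand F \<alpha> z (r * t))"

text \<open>Posed on the whole line rather than on [0, R], because dilation and blow-up evaluate the
  same function at arbitrary radii.\<close>

definition sol :: "(real \<Rightarrow> real) \<Rightarrow> real \<Rightarrow> (real \<Rightarrow> real) \<Rightarrow> bool" where
  "sol F \<alpha> z \<longleftrightarrow> continuous_on UNIV z \<and> (\<forall>r. z r = T F \<alpha> z r)"

lemma ell_pos: "ell > 0"
  using a_pos b_pos by (simp add: ell_def)

lemma m_inv_diff:
  assumes "x \<le> y"
  shows "0 \<le> m_inv y - m_inv x" "m_inv y - m_inv x \<le> (y - x) / ell"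
proof -
  have "max (1 / a) (1 / b) = 1 / ell"
    using a_pos b_pos by (auto simp: ell_def max_def min_def field_simps)
  then show "0 \<le> m_inv y - m_inv x" "m_inv y - m_inv x \<le> (y - x) / ell"
    using two_slope_diff[of "1 / a" "1 / b" x y] a_pos b_pos assms by auto
qed

lemma m_inv_lipschitz: "\<bar>m_inv x - m_inv y\<bar> \<le> \<bar>x - y\<bar> / ell"
  using m_inv_diff[of x y] m_inv_diff[of y x] by (cases "x \<le> y") (auto simp: abs_if)

lemma m_lipschitz: "\<bar>m x - m y\<bar> \<le> max a b * \<bar>x - y\<bar>"
  using two_slope_diff[of a b x y] two_slope_diff[of a b y x] a_pos b_pos
  by (cases "x \<le> y") (auto simp: abs_if)

lemma m_m_inv [simp]: "m (m_inv x) = x"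
  by (rule two_slope_inverse[OF a_pos b_pos])

lemma m_H: "m (H z c) = - \<nu> * m z - c"
  by (simp add: H_def)

lemma m_inv_sgn: "m_inv x \<ge> 0 \<longleftrightarrow> x \<ge> 0" "m_inv x \<le> 0 \<longleftrightarrow> x \<le> 0"
  using two_slope_sgn[of "1 / a" "1 / b" x] a_pos b_pos by auto

lemma m_sgn: "m x \<ge> 0 \<longleftrightarrow> x \<ge> 0" "m x \<le> 0 \<longleftrightarrow> x \<le> 0"
  using two_slope_sgn[OF a_pos b_pos] by auto

lemma m_0 [simp]: "m 0 = 0" "m_inv 0 = 0"
  by (auto simp: two_slope_def)

text \<open>Multiplication by a nonnegative factor respects the kink of m. This homogeneity replaces
  linearity in every rescaling below.\<close>

lemma H_scale: "c \<ge> 0 \<Longrightarrow> H (c * z) (c * d) = c * H z d"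
  using two_slope_scale[of c a b z] two_slope_scale[of c "1 / a" "1 / b" "- \<nu> * m z - d"]
  by (simp add: H_def algebra_simps)

lemma H_lipschitz_right: "\<bar>H z c - H z d\<bar> \<le> \<bar>c - d\<bar> / ell"
  using m_inv_lipschitz[of "- \<nu> * m z - c" "- \<nu> * m z - d"] by (simp add: H_def abs_minus_commute)

lemma H_lipschitz_left: "\<bar>H z c - H w c\<bar> \<le> real N * \<bar>z - w\<bar>"
proof -
  have "\<bar>H z c - H w c\<bar> \<le> \<bar>\<nu> * (m z - m w)\<bar> / ell"
    using m_inv_lipschitz[of "- \<nu> * m z - c" "- \<nu> * m w - c"]
    by (simp add: H_def abs_minus_commute algebra_simps)
  also have "\<dots> = \<nu> * \<bar>m z - m w\<bar> / ell" using \<nu>_nonneg by (simp add: abs_mult)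
  also have "\<dots> \<le> \<nu> * (max a b * \<bar>z - w\<bar>) / ell"
    using \<nu>_nonneg ell_pos m_lipschitz by (intro divide_right_mono mult_left_mono) auto
  also have "\<dots> = \<nu> * (max a b / ell) * \<bar>z - w\<bar>" by simp
  also have "\<dots> \<le> real N * \<bar>z - w\<bar>" using N_ge unfolding ell_def by (intro mult_right_mono) auto
  finally show ?thesis .
qed

lemma H_antimono_left: "z \<le> w \<Longrightarrow> H w c \<le> H z c"
proof -
  assume "z \<le> w"
  then have "m z \<le> m w" using two_slope_diff[of a b z w] a_pos b_pos by auto
  then have "- \<nu> * m w - c \<le> - \<nu> * m z - c" using \<nu>_nonneg mult_left_mono by auto
  from m_inv_diff(1)[OF this] show ?thesis by (simp add: H_def)
qed

text \<open>The point of the shift by \<^term>\<open>real N * z\<close>: the Lipschitz constant in \<^term>\<open>z\<close> stays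
  \<^term>\<open>N\<close>, which the integral against \<^term>\<open>t ^ N\<close> turns into a contraction.\<close>

lemma H_shift_lipschitz:
  "\<bar>(H z c + real N * z) - (H w d + real N * w)\<bar> \<le> real N * \<bar>z - w\<bar> + \<bar>c - d\<bar> / ell"
proof -
  \<comment> \<open>\<open>H\<close> decreases in z at rate at most \<open>N\<close>, so the shifted
    map increases at rate at most \<open>N\<close>. The triangle inequality alone would give 2 N,
    too much for the factor 1 / (N + 1) once N is positive.\<close>
  have "\<bar>(H z c + real N * z) - (H w c + real N * w)\<bar> \<le> real N * \<bar>z - w\<bar>"
    using H_antimono_left[of z w c] H_antimono_left[of w z c] H_lipschitz_left[of z c w]
    by (cases "z \<le> w") (auto simp: abs_if algebra_simps split: if_splits)
  with H_lipschitz_right[of w c d] show ?thesis by (simp add: abs_if split: if_splits)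
qed

lemma continuous_on_H [continuous_intros]:
  assumes "continuous_on S f" "continuous_on S h"
  shows "continuous_on S (\<lambda>x. H (f x) (h x))"
  unfolding H_def two_slope_def by (intro continuous_intros assms)

lemma continuous_on_radial_v:
  assumes "continuous_on UNIV z"
  shows "continuous_on UNIV (radial_v \<alpha> z)"
proof -
  have "continuous_on UNIV (\<lambda>r. integral {0..1} (\<lambda>t. t * z (r * t)))"
    using continuous_on_dilation_integral[OF assms, of 1] by simp
  then show ?thesis unfolding radial_v_def by (intro continuous_intros)
qed

lemma continuous_on_integrand:
  assumes "continuous_on UNIV z" "continuous_on UNIV F"
  shows "continuous_on UNIV (integrand F \<alpha> z)"
  unfolding integrand_def
  by (intro continuous_intros assms continuous_on_compose2[OF assms(2) continuous_on_radial_v[OF assms(1)]]) auto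

lemma continuous_on_T:
  assumes "continuous_on UNIV z" "continuous_on UNIV F"
  shows "continuous_on UNIV (T F \<alpha> z)"
  unfolding T_def by (rule continuous_on_dilation_integral[OF continuous_on_integrand[OF assms]])

lemma integrable_dilation:
  assumes "continuous_on UNIV (X :: real \<Rightarrow> real)"
  shows "(\<lambda>t. t ^ k * X (r * t)) integrable_on {0..1::real}"
  by (intro integrable_continuous_interval continuous_intros continuous_on_compose2[OF assms]) auto

lemma radial_v_diff:
  assumes z: "continuous_on UNIV z" "continuous_on UNIV w"
    and D: "\<And>t. t \<in> {0..1} \<Longrightarrow> \<bar>z (r * t) - w (r * t)\<bar> \<le> D * exp (L * (r * t)\<^sup>2)"
    and L: "L > 0"
  shows "\<bar>radial_v \<alpha> z r - radial_v \<beta> w r\<bar> \<le> \<bar>\<alpha> - \<beta>\<bar> + D * exp (L * r\<^sup>2) / (2 * L)"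
proof -
  have D0: "D \<ge> 0" using D[of 0] by auto
  have zi: "(\<lambda>t. t * z (r * t)) integrable_on {0..1}" and wi: "(\<lambda>t. t * w (r * t)) integrable_on {0..1}"
    using integrable_dilation[OF z(1), of 1 r] integrable_dilation[OF z(2), of 1 r] by auto
  have "r\<^sup>2 * integral {0..1} (\<lambda>t. t * z (r * t)) - r\<^sup>2 * integral {0..1} (\<lambda>t. t * w (r * t))
      = r\<^sup>2 * integral {0..1} (\<lambda>t. t * z (r * t) - t * w (r * t))"
    by (subst integral_diff[OF zi wi]) (simp add: algebra_simps)
  also have "\<dots> = integral {0..1} (\<lambda>t. r\<^sup>2 * (t * z (r * t) - t * w (r * t)))"
    by simp
  finally have eq: "radial_v \<alpha> z r - radial_v \<beta> w r
      = \<alpha> - \<beta> + integral {0..1} (\<lambda>t. r\<^sup>2 * (t * z (r * t) - t * w (r * t)))"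
    by (simp add: radial_v_def)
  have "norm (integral {0..1} (\<lambda>t. r\<^sup>2 * (t * z (r * t) - t * w (r * t))))
      \<le> integral {0..1} (\<lambda>t. D * (r\<^sup>2 * (t * exp (L * (r * t)\<^sup>2))))"
  proof (rule integral_norm_bound_integral)
    show "(\<lambda>t. r\<^sup>2 * (t * z (r * t) - t * w (r * t))) integrable_on {0..1}"
      by (intro integrable_on_mult_right integrable_diff zi wi)
    show "(\<lambda>t. D * (r\<^sup>2 * (t * exp (L * (r * t)\<^sup>2)))) integrable_on {0..1}"
      by (rule integrable_on_mult_right[OF has_integral_integrable[OF has_integral_gauss_01[OF L]]])
    fix t :: real assume t: "t \<in> {0..1}"
    have "norm (r\<^sup>2 * (t * z (r * t) - t * w (r * t))) = r\<^sup>2 * (t * \<bar>z (r * t) - w (r * t)\<bar>)"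
      using t by (simp add: abs_mult flip: right_diff_distrib)
    also have "\<dots> \<le> r\<^sup>2 * (t * (D * exp (L * (r * t)\<^sup>2)))"
      using D[OF t] t by (intro mult_left_mono) auto
    finally show "norm (r\<^sup>2 * (t * z (r * t) - t * w (r * t))) \<le> D * (r\<^sup>2 * (t * exp (L * (r * t)\<^sup>2)))"
      by (simp add: algebra_simps)
  qed
  also have "\<dots> = D * ((exp (L * r\<^sup>2) - 1) / (2 * L))"
    by (rule integral_unique[OF has_integral_mult_right[OF has_integral_gauss_01[OF L]]])
  also have "\<dots> \<le> D * (exp (L * r\<^sup>2) / (2 * L))"
    using D0 L by (intro mult_left_mono divide_right_mono) auto
  finally show ?thesis unfolding eq by (simp add: abs_if split: if_splits)
qed

text \<open>Growth rate of the weight \<open>exp (rate K * r\<^sup>2)\<close> in which \<open>T\<close> is a contraction on all of the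
  real line when \<open>F\<close> is \<open>K\<close>-Lipschitz.\<close>

definition rate :: "real \<Rightarrow> real" where "rate K = K / ell + 1"

text \<open>The summand 1 in \<open>rate\<close> keeps it positive for K = 0. The bound 1/2 is the
  share of F in the contraction constant and leads to (N + 1/2) / (N + 1) < 1.\<close>

lemma rate: "K \<ge> 0 \<Longrightarrow> rate K > 0" "K \<ge> 0 \<Longrightarrow> K / (2 * rate K * ell) \<le> 1 / 2"
proof -
  assume K: "K \<ge> 0"
  then show p: "rate K > 0" using ell_pos by (simp add: rate_def add_nonneg_pos)
  have "K \<le> rate K * ell" using ell_pos by (simp add: rate_def field_simps)
  moreover have "rate K * ell > 0" using p ell_pos by simp
  ultimately show "K / (2 * rate K * ell) \<le> 1 / 2" by (simp add: field_simps)
qed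

text \<open>One estimate for two purposes: with equal nonlinearities and initial values it is the
  contraction property of \<open>T\<close>, otherwise it measures continuous dependence. Only
  \<open>F\<close> is Lipschitz; \<open>G\<close> is compared with it along \<open>w\<close>
  alone.\<close>

lemma T_diff:
  assumes z: "continuous_on UNIV z" "continuous_on UNIV w"
    and F: "K-lipschitz_on UNIV F" and G: "continuous_on UNIV G"
    and D: "\<And>t. t \<in> {0..1} \<Longrightarrow> \<bar>z (r * t) - w (r * t)\<bar> \<le> D * exp (rate K * (r * t)\<^sup>2)"
    and \<epsilon>: "\<And>t. t \<in> {0..1} \<Longrightarrow> \<bar>F (radial_v \<beta> w (r * t)) - G (radial_v \<beta> w (r * t))\<bar> \<le> \<epsilon>"
  shows "\<bar>T F \<alpha> z r - T G \<beta> w r\<bar>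
    \<le> (real N + 1 / 2) / (real N + 1) * (D * exp (rate K * r\<^sup>2)) + (\<epsilon> + K * \<bar>\<alpha> - \<beta>\<bar>) / ell"
proof -
  have K: "K \<ge> 0" using F by (rule lipschitz_on_nonneg)
  let ?L = "rate K"
  have L: "?L > 0" using rate K by auto
  have D0: "D \<ge> 0" using D[of 0] by auto
  have \<epsilon>0: "\<epsilon> \<ge> 0" using \<epsilon>[of 0] by auto
  have cF: "continuous_on UNIV F" using F by (rule lipschitz_on_continuous_on)
  define E where "E = D * exp (?L * r\<^sup>2)"
  have E0: "E \<ge> 0" using D0 by (simp add: E_def)
  define B where "B = (real N + 1 / 2) * E + (\<epsilon> + K * \<bar>\<alpha> - \<beta>\<bar>) / ell"
  have B0: "B \<ge> 0" using E0 \<epsilon>0 K ell_pos by (simp add: B_def)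
  have bnd: "\<bar>integrand F \<alpha> z (r * t) - integrand G \<beta> w (r * t)\<bar> \<le> B" if t: "t \<in> {0..1}" for t
  proof -
    let ?q = "r * t"
    have sq: "D * exp (?L * ?q\<^sup>2) \<le> E"
    proof -
      have "t\<^sup>2 \<le> 1" using t by (simp add: power_le_one)
      then have "?q\<^sup>2 \<le> r\<^sup>2" by (simp add: power_mult_distrib mult_left_le)
      then have "exp (?L * ?q\<^sup>2) \<le> exp (?L * r\<^sup>2)" using L by simp
      then show ?thesis unfolding E_def using D0 by (rule mult_left_mono)
    qed
    have "\<bar>radial_v \<alpha> z ?q - radial_v \<beta> w ?q\<bar> \<le> \<bar>\<alpha> - \<beta>\<bar> + D * exp (?L * ?q\<^sup>2) / (2 * ?L)"
    proof (rule radial_v_diff[OF z _ L])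
      fix u :: real assume "u \<in> {0..1}"
      then have "t * u \<in> {0..1}" using t by (auto simp: mult_le_one)
      from D[OF this] show "\<bar>z (r * t * u) - w (r * t * u)\<bar> \<le> D * exp (?L * (r * t * u)\<^sup>2)"
        by (simp add: mult.assoc)
    qed
    also have "\<dots> \<le> \<bar>\<alpha> - \<beta>\<bar> + E / (2 * ?L)"
      using sq L by (intro add_left_mono divide_right_mono) auto
    finally have v: "\<bar>radial_v \<alpha> z ?q - radial_v \<beta> w ?q\<bar> \<le> \<bar>\<alpha> - \<beta>\<bar> + E / (2 * ?L)" .
    have "\<bar>F (radial_v \<alpha> z ?q) - F (radial_v \<beta> w ?q)\<bar> \<le> K * \<bar>radial_v \<alpha> z ?q - radial_v \<beta> w ?q\<bar>"
      using lipschitz_onD[OF F, of "radial_v \<alpha> z ?q" "radial_v \<beta> w ?q"] by (simp add: dist_real_def)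
    also have "\<dots> \<le> K * (\<bar>\<alpha> - \<beta>\<bar> + E / (2 * ?L))" using v K by (rule mult_left_mono)
    finally have "\<bar>F (radial_v \<alpha> z ?q) - G (radial_v \<beta> w ?q)\<bar> \<le> K * (\<bar>\<alpha> - \<beta>\<bar> + E / (2 * ?L)) + \<epsilon>"
      using \<epsilon>[OF t] by linarith
    then have "\<bar>F (radial_v \<alpha> z ?q) - G (radial_v \<beta> w ?q)\<bar> / ell
        \<le> (K * (\<bar>\<alpha> - \<beta>\<bar> + E / (2 * ?L)) + \<epsilon>) / ell"
      using ell_pos by (intro divide_right_mono) auto
    also have "\<dots> = (K / (2 * ?L * ell)) * E + (\<epsilon> + K * \<bar>\<alpha> - \<beta>\<bar>) / ell"
      using ell_pos L by (simp add: field_simps)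
    also have "\<dots> \<le> 1 / 2 * E + (\<epsilon> + K * \<bar>\<alpha> - \<beta>\<bar>) / ell"
      using rate(2)[OF K] E0 by (intro add_right_mono mult_right_mono) auto
    finally have g: "\<bar>F (radial_v \<alpha> z ?q) - G (radial_v \<beta> w ?q)\<bar> / ell \<le> 1 / 2 * E + (\<epsilon> + K * \<bar>\<alpha> - \<beta>\<bar>) / ell" .
    have "real N * \<bar>z ?q - w ?q\<bar> \<le> real N * E"
      using D[OF t] sq by (intro mult_left_mono) auto
    with g H_shift_lipschitz[of "z ?q" "F (radial_v \<alpha> z ?q)" "w ?q" "G (radial_v \<beta> w ?q)"]
    show ?thesis unfolding integrand_def B_def by (simp add: algebra_simps)
  qed
  have i1: "(\<lambda>t. t ^ N * integrand F \<alpha> z (r * t)) integrable_on {0..1}"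
    by (rule integrable_dilation[OF continuous_on_integrand[OF z(1) cF]])
  have i2: "(\<lambda>t. t ^ N * integrand G \<beta> w (r * t)) integrable_on {0..1}"
    by (rule integrable_dilation[OF continuous_on_integrand[OF z(2) G]])
  have "norm (integral {0..1} (\<lambda>t. t ^ N * integrand F \<alpha> z (r * t) - t ^ N * integrand G \<beta> w (r * t)))
      \<le> integral {0..1} (\<lambda>t. B * t ^ N)"
  proof (rule integral_norm_bound_integral)
    show "(\<lambda>t. B * t ^ N) integrable_on {0..1}"
      by (rule integrable_on_mult_right[OF has_integral_integrable[OF has_integral_power_01]])
    fix t :: real assume t: "t \<in> {0..1}"
    show "norm (t ^ N * integrand F \<alpha> z (r * t) - t ^ N * integrand G \<beta> w (r * t)) \<le> B * t ^ N"
      using mult_left_mono[OF bnd[OF t], of "t ^ N"] t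
      by (simp add: abs_mult mult.commute flip: right_diff_distrib)
  qed (intro integrable_diff i1 i2)
  also have "\<dots> = B / (real N + 1)"
    using has_integral_power_01[of N] by (simp add: integral_unique)
  also have "\<dots> = (real N + 1 / 2) / (real N + 1) * E + (\<epsilon> + K * \<bar>\<alpha> - \<beta>\<bar>) / ell / (real N + 1)"
    unfolding B_def by (subst add_divide_distrib) simp
  also have "\<dots> \<le> (real N + 1 / 2) / (real N + 1) * E + (\<epsilon> + K * \<bar>\<alpha> - \<beta>\<bar>) / ell"
  proof -
    have "(\<epsilon> + K * \<bar>\<alpha> - \<beta>\<bar>) / ell / (real N + 1) \<le> (\<epsilon> + K * \<bar>\<alpha> - \<beta>\<bar>) / ell / 1"
      using \<epsilon>0 K ell_pos by (intro divide_left_mono) auto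
    then show ?thesis by simp
  qed
  finally show ?thesis unfolding T_def E_def by (simp add: integral_diff[OF i1 i2])
qed

text \<open>At a maximum point of the weighted difference on [0, \<rho>], \<open>T_diff\<close>
  bounds the maximum D by q D + C with 1 - q = 1 / (2 (N + 1)). This is the origin of the factor 2
  (N + 1).\<close>

lemma stability:
  assumes z: "sol F \<alpha> z" and w: "sol G \<beta> w"
    and F: "K-lipschitz_on UNIV F" and G: "continuous_on UNIV G"
    and \<epsilon>: "\<And>r. r \<in> {0..\<rho>} \<Longrightarrow> \<bar>F (radial_v \<beta> w r) - G (radial_v \<beta> w r)\<bar> \<le> \<epsilon>"
    and r: "r \<in> {0..\<rho>}"
  shows "\<bar>radial_v \<alpha> z r - radial_v \<beta> w r\<bar>
      \<le> \<bar>\<alpha> - \<beta>\<bar> + 2 * (real N + 1) * (\<epsilon> + K * \<bar>\<alpha> - \<beta>\<bar>) / ell * exp (rate K * \<rho>\<^sup>2) / (2 * rate K)"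
proof -
  have K: "K \<ge> 0" using F by (rule lipschitz_on_nonneg)
  let ?L = "rate K"
  have L: "?L > 0" using rate K by auto
  have \<epsilon>0: "\<epsilon> \<ge> 0" using \<epsilon>[of 0] r by auto
  have zc: "continuous_on UNIV z" and wc: "continuous_on UNIV w" using z w by (auto simp: sol_def)
  let ?h = "\<lambda>r. \<bar>z r - w r\<bar> * exp (- ?L * r\<^sup>2)"
  have "continuous_on {0..\<rho>} ?h"
    by (intro continuous_intros continuous_on_subset[OF zc] continuous_on_subset[OF wc]) auto
  then obtain x where x: "x \<in> {0..\<rho>}" and xmax: "\<And>y. y \<in> {0..\<rho>} \<Longrightarrow> ?h y \<le> ?h x"
    using continuous_attains_sup[of "{0..\<rho>}" ?h] r by force
  define D where "D = ?h x"
  have D: "\<bar>z y - w y\<bar> \<le> D * exp (?L * y\<^sup>2)" if "y \<in> {0..\<rho>}" for y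
    using xmax[OF that] unfolding D_def[symmetric] by (simp add: exp_minus field_simps)
  have D0: "D \<ge> 0" by (simp add: D_def)
  define C where "C = (\<epsilon> + K * \<bar>\<alpha> - \<beta>\<bar>) / ell"
  have C0: "C \<ge> 0" using \<epsilon>0 K ell_pos by (simp add: C_def)
  have sub: "x * t \<in> {0..\<rho>}" if "t \<in> {0..1}" for t
    using x that mult_left_le[of t x] by (auto intro: order_trans)
  have "\<bar>z x - w x\<bar> = \<bar>T F \<alpha> z x - T G \<beta> w x\<bar>" using z w by (simp add: sol_def)
  also have "\<dots> \<le> (real N + 1 / 2) / (real N + 1) * (D * exp (?L * x\<^sup>2)) + C"
    unfolding C_def using sub D \<epsilon> by (intro T_diff zc wc F G) auto
  finally have "D \<le> ((real N + 1 / 2) / (real N + 1) * (D * exp (?L * x\<^sup>2)) + C) * exp (- ?L * x\<^sup>2)"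
    unfolding D_def by (intro mult_right_mono) auto
  also have "\<dots> = (real N + 1 / 2) / (real N + 1) * D + C * exp (- ?L * x\<^sup>2)"
    by (simp add: algebra_simps flip: exp_add)
  also have "\<dots> \<le> (real N + 1 / 2) / (real N + 1) * D + C"
    using C0 L by (intro add_left_mono mult_left_le) auto
  finally have "D * (1 - (real N + 1 / 2) / (real N + 1)) \<le> C" by (simp add: algebra_simps)
  moreover have "1 - (real N + 1 / 2) / (real N + 1) = 1 / (2 * (real N + 1))" by (simp add: field_simps)
  ultimately have DC: "D \<le> 2 * (real N + 1) * C" by (simp add: field_simps)
  have le: "D * exp (?L * y\<^sup>2) \<le> 2 * (real N + 1) * C * exp (?L * \<rho>\<^sup>2)" if "y \<in> {0..\<rho>}" for y
  proof -
    have "exp (?L * y\<^sup>2) \<le> exp (?L * \<rho>\<^sup>2)" using that L by (auto intro: power_mono)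
    then show ?thesis by (rule mult_mono[OF DC]) (use C0 in auto)
  qed
  have "r * t \<in> {0..\<rho>}" if "t \<in> {0..1}" for t
    using r that mult_left_le[of t r] by (auto intro: order_trans)
  then have "\<bar>radial_v \<alpha> z r - radial_v \<beta> w r\<bar> \<le> \<bar>\<alpha> - \<beta>\<bar> + D * exp (?L * r\<^sup>2) / (2 * ?L)"
    using D by (intro radial_v_diff zc wc L) auto
  also have "\<dots> \<le> \<bar>\<alpha> - \<beta>\<bar> + 2 * (real N + 1) * C * exp (?L * \<rho>\<^sup>2) / (2 * ?L)"
    using le[OF r] L by (intro add_left_mono divide_right_mono) auto
  finally show "\<bar>radial_v \<alpha> z r - radial_v \<beta> w r\<bar>
      \<le> \<bar>\<alpha> - \<beta>\<bar> + 2 * (real N + 1) * (\<epsilon> + K * \<bar>\<alpha> - \<beta>\<bar>) / ell * exp (?L * \<rho>\<^sup>2) / (2 * ?L)"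
    by (simp add: C_def)
qed

text \<open>Anchors the boundedness argument in \<open>sol_exists\<close>: weighted images of
  bounded functions stay within bounded distance of the image of 0, which is constant before
  weighting.\<close>

lemma T_at_zero_function: "T F \<alpha> (\<lambda>_. 0) r = H 0 (F \<alpha>) / (real N + 1)"
proof -
  have "integral {0..1} (\<lambda>t. t ^ N * H 0 (F \<alpha>)) = 1 / (real N + 1) * H 0 (F \<alpha>)"
    by (rule integral_unique[OF has_integral_mult_left[OF has_integral_power_01]])
  then show ?thesis by (simp add: T_def integrand_def radial_v_def)
qed

lemma sol_exists:
  assumes F: "K-lipschitz_on UNIV F"
  shows "\<exists>z. sol F \<alpha> z"
proof -
  have K: "K \<ge> 0" using F by (rule lipschitz_on_nonneg)
  let ?L = "rate K"
  have L: "?L > 0" using rate K by auto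
  have cF: "continuous_on UNIV F" using F by (rule lipschitz_on_continuous_on)
  define q where "q = (real N + 1 / 2) / (real N + 1)"
  have q: "0 \<le> q" "q < 1" by (auto simp: q_def field_simps)
  \<comment> \<open>\<open>up\<close> removes the weight: bounded continuous functions correspond to
    continuous functions growing at most like exp(L r^2), and \<open>S\<close> is \<open>T\<close>
    conjugated by this correspondence.\<close>
  define up where "up = (\<lambda>\<zeta> :: real \<Rightarrow>\<^sub>C real. \<lambda>r. exp (?L * r\<^sup>2) * \<zeta> r)"
  have upc: "continuous_on UNIV (up \<zeta>)" for \<zeta> unfolding up_def by (intro continuous_intros) auto
  define S where "S = (\<lambda>\<zeta> r. exp (- ?L * r\<^sup>2) * T F \<alpha> (up \<zeta>) r)"
  have diff: "\<bar>S \<zeta> r - exp (- ?L * r\<^sup>2) * T F \<alpha> w r\<bar> \<le> q * D"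
    if w: "continuous_on UNIV w" and D: "\<And>r. \<bar>up \<zeta> r - w r\<bar> \<le> D * exp (?L * r\<^sup>2)" for \<zeta> w D r
  proof -
    have "\<bar>T F \<alpha> (up \<zeta>) r - T F \<alpha> w r\<bar> \<le> q * (D * exp (?L * r\<^sup>2)) + (0 + K * \<bar>\<alpha> - \<alpha>\<bar>) / ell"
      unfolding q_def by (intro T_diff upc w F cF D) auto
    then have "exp (- ?L * r\<^sup>2) * \<bar>T F \<alpha> (up \<zeta>) r - T F \<alpha> w r\<bar> \<le> exp (- ?L * r\<^sup>2) * (q * (D * exp (?L * r\<^sup>2)))"
      by (intro mult_left_mono) auto
    also have "\<dots> = q * D" by (simp add: exp_minus field_simps)
    finally show ?thesis unfolding S_def by (simp add: abs_mult flip: right_diff_distrib)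
  qed
  have Sb: "S \<zeta> \<in> bcontfun" for \<zeta>
  proof -
    have "continuous_on UNIV (S \<zeta>)"
      unfolding S_def by (intro continuous_intros continuous_on_T upc cF)
    moreover have "\<bar>S \<zeta> r\<bar> \<le> q * norm \<zeta> + \<bar>H 0 (F \<alpha>) / (real N + 1)\<bar>" for r
    proof -
      have "\<bar>S \<zeta> r - exp (- ?L * r\<^sup>2) * T F \<alpha> (\<lambda>_. 0) r\<bar> \<le> q * norm \<zeta>"
      proof (rule diff)
        fix r show "\<bar>up \<zeta> r - 0\<bar> \<le> norm \<zeta> * exp (?L * r\<^sup>2)"
          using norm_bounded[of \<zeta> r] by (simp add: up_def abs_mult mult.commute mult_right_mono)
      qed auto
      moreover have "\<bar>exp (- ?L * r\<^sup>2) * T F \<alpha> (\<lambda>_. 0) r\<bar> \<le> \<bar>H 0 (F \<alpha>) / (real N + 1)\<bar>"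
      proof -
        have "exp (- ?L * r\<^sup>2) \<le> 1" using L by simp
        then show ?thesis unfolding T_at_zero_function abs_mult
          using mult_right_mono[of "exp (- ?L * r\<^sup>2)" 1 "\<bar>H 0 (F \<alpha>) / (real N + 1)\<bar>"] by simp
      qed
      ultimately show ?thesis by linarith
    qed
    ultimately show ?thesis by (auto simp: bcontfun_def intro!: boundedI)
  qed
  define \<Phi> where "\<Phi> = (\<lambda>\<zeta>. Bcontfun (S \<zeta>))"
  have \<Phi>: "apply_bcontfun (\<Phi> \<zeta>) = S \<zeta>" for \<zeta>
    unfolding \<Phi>_def using Sb by (rule Bcontfun_inverse)
  have "dist (\<Phi> \<zeta>) (\<Phi> \<xi>) \<le> q * dist \<zeta> \<xi>" for \<zeta> \<xi>
  proof (rule dist_bound)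
    fix r
    have "\<bar>S \<zeta> r - exp (- ?L * r\<^sup>2) * T F \<alpha> (up \<xi>) r\<bar> \<le> q * dist \<zeta> \<xi>"
    proof (rule diff[OF upc])
      fix r show "\<bar>up \<zeta> r - up \<xi> r\<bar> \<le> dist \<zeta> \<xi> * exp (?L * r\<^sup>2)"
        using mult_right_mono[OF dist_bounded[of \<zeta> r \<xi>], of "exp (?L * r\<^sup>2)"]
        by (simp add: up_def abs_mult mult.commute[of "exp _"] dist_real_def flip: left_diff_distrib)
    qed
    then show "dist (\<Phi> \<zeta> r) (\<Phi> \<xi> r) \<le> q * dist \<zeta> \<xi>"
      unfolding \<Phi> by (simp add: S_def dist_real_def)
  qed
  then obtain \<zeta> where "\<Phi> \<zeta> = \<zeta>"
    using banach_fix_type[OF q, of \<Phi>] by auto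
  then have "\<zeta> r = S \<zeta> r" for r using \<Phi>[of \<zeta>] by simp
  then have "up \<zeta> r = exp (?L * r\<^sup>2) * S \<zeta> r" for r
    unfolding up_def by (rule arg_cong)
  then have "up \<zeta> r = exp (?L * r\<^sup>2) * (exp (- ?L * r\<^sup>2) * T F \<alpha> (up \<zeta>) r)" for r
    by (simp only: S_def)
  then have "up \<zeta> r = T F \<alpha> (up \<zeta>) r" for r
    by (simp add: mult.assoc[symmetric] flip: exp_add)
  then show ?thesis using upc by (auto simp: sol_def)
qed

text \<open>If v(r) becomes c v(\<beta> r), then v'/r picks up the factor c \<beta>^2, and by
  homogeneity of \<open>H\<close> so does the nonlinearity. With \<beta> = 1 this normalises the
  initial value, with c = 1 it dilates the domain.\<close>

lemma sol_scale:
  assumes z: "sol F \<alpha> z" and c: "c > 0"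
  shows "sol (\<lambda>t. c * \<beta>\<^sup>2 * F (t / c)) (c * \<alpha>) (\<lambda>r. c * \<beta>\<^sup>2 * z (\<beta> * r))"
    and "radial_v (c * \<alpha>) (\<lambda>r. c * \<beta>\<^sup>2 * z (\<beta> * r)) r = c * radial_v \<alpha> z (\<beta> * r)"
proof -
  have zc: "continuous_on UNIV z" and zT: "\<And>r. z r = T F \<alpha> z r" using z by (auto simp: sol_def)
  have v: "radial_v (c * \<alpha>) (\<lambda>r. c * \<beta>\<^sup>2 * z (\<beta> * r)) r = c * radial_v \<alpha> z (\<beta> * r)" for r
  proof -
    have "integral {0..1} (\<lambda>t. t * (c * \<beta>\<^sup>2 * z (\<beta> * (r * t)))) = integral {0..1} (\<lambda>t. c * \<beta>\<^sup>2 * (t * z (\<beta> * r * t)))"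
      by (rule integral_cong) (simp add: mult_ac)
    also have "\<dots> = c * \<beta>\<^sup>2 * integral {0..1} (\<lambda>t. t * z (\<beta> * r * t))" by simp
    finally show ?thesis unfolding radial_v_def by (simp add: algebra_simps power_mult_distrib)
  qed
  have I: "integrand (\<lambda>t. c * \<beta>\<^sup>2 * F (t / c)) (c * \<alpha>) (\<lambda>r. c * \<beta>\<^sup>2 * z (\<beta> * r)) q
      = c * \<beta>\<^sup>2 * integrand F \<alpha> z (\<beta> * q)" for q
    using c H_scale[of "c * \<beta>\<^sup>2" "z (\<beta> * q)" "F (radial_v \<alpha> z (\<beta> * q))"]
    unfolding integrand_def v by (simp add: algebra_simps)
  have "c * \<beta>\<^sup>2 * z (\<beta> * r) = T (\<lambda>t. c * \<beta>\<^sup>2 * F (t / c)) (c * \<alpha>) (\<lambda>r. c * \<beta>\<^sup>2 * z (\<beta> * r)) r" for r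
  proof -
    have "integral {0..1} (\<lambda>t. t ^ N * (c * \<beta>\<^sup>2 * integrand F \<alpha> z (\<beta> * (r * t))))
        = integral {0..1} (\<lambda>t. c * \<beta>\<^sup>2 * (t ^ N * integrand F \<alpha> z (\<beta> * r * t)))"
      by (rule integral_cong) (simp add: mult_ac)
    also have "\<dots> = c * \<beta>\<^sup>2 * T F \<alpha> z (\<beta> * r)" by (simp add: T_def)
    finally show ?thesis unfolding T_def I using zT by (simp add: T_def)
  qed
  moreover have "continuous_on UNIV (\<lambda>r. c * \<beta>\<^sup>2 * z (\<beta> * r))"
    by (intro continuous_intros continuous_on_compose2[OF zc]) auto
  ultimately show "sol (\<lambda>t. c * \<beta>\<^sup>2 * F (t / c)) (c * \<alpha>) (\<lambda>r. c * \<beta>\<^sup>2 * z (\<beta> * r))"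
    unfolding sol_def by (intro conjI allI)
  show "radial_v (c * \<alpha>) (\<lambda>r. c * \<beta>\<^sup>2 * z (\<beta> * r)) r = c * radial_v \<alpha> z (\<beta> * r)" by (rule v)
qed

section \<open>From the fixed point back to the differential equation\<close>

lemma radial_v_0 [simp]: "radial_v \<alpha> z 0 = \<alpha>"
  by (simp add: radial_v_def)

lemma radial_v_deriv:
  assumes "continuous_on UNIV z"
  shows "(radial_v \<alpha> z has_real_derivative r * z r) (at r within S)"
proof -
  have "((\<lambda>r. r\<^sup>2 * integral {0..1} (\<lambda>t. t * z (r * t))) has_real_derivative r * z r) (at r)"
    using has_real_derivative_dilation_integral[OF assms, of 1 r] by (simp add: power2_eq_square)
  then have "(radial_v \<alpha> z has_real_derivative r * z r) (at r)"
    using DERIV_add[OF DERIV_const[of \<alpha>]] unfolding radial_v_def by force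
  then show ?thesis by (rule has_field_derivative_at_within)
qed

text \<open>As r z = v', this is the formula for v''. The derivative of r^(N+1) z is r^N (H + N z),
  and dividing r^(N+1) z by r^N takes the term N z away again, so the auxiliary exponent
  disappears.\<close>

lemma sol_ode:
  assumes z: "sol F \<alpha> z" and F: "continuous_on UNIV F" and r: "r > 0"
  shows "((\<lambda>r. r * z r) has_real_derivative H (z r) (F (radial_v \<alpha> z r))) (at r)"
proof -
  have zc: "continuous_on UNIV z" and zT: "\<And>r. z r = T F \<alpha> z r" using z by (auto simp: sol_def)
  have d: "((\<lambda>r. r ^ Suc N * T F \<alpha> z r) has_real_derivative r ^ N * integrand F \<alpha> z r) (at r)"
    unfolding T_def by (rule has_real_derivative_dilation_integral[OF continuous_on_integrand[OF zc F]])
  have "((\<lambda>r. (r ^ Suc N * T F \<alpha> z r) / r ^ N) has_real_derivative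
      ((r ^ N * integrand F \<alpha> z r) * r ^ N - (r ^ Suc N * T F \<alpha> z r) * (real N * r ^ (N - 1))) / (r ^ N * r ^ N)) (at r)"
    using r by (intro DERIV_divide[OF d]) (auto intro!: derivative_eq_intros)
  moreover have "((r ^ N * integrand F \<alpha> z r) * r ^ N - (r ^ Suc N * T F \<alpha> z r) * (real N * r ^ (N - 1))) / (r ^ N * r ^ N)
      = H (z r) (F (radial_v \<alpha> z r))"
  proof -
    have e: "r ^ Suc N * T F \<alpha> z r * (real N * r ^ (N - 1)) = r ^ N * r ^ N * (real N * z r)"
    proof -
      have "r * (real N * r ^ (N - 1)) = real N * (r ^ (N - 1) * r)" by (simp only: mult_ac)
      also have "\<dots> = r ^ N * real N"
        using power_minus_mult[of N r] by (cases "N = 0") (simp_all only: of_nat_0 mult_zero_left mult_zero_right neq0_conv mult_ac)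
      finally have "r * (real N * r ^ (N - 1)) = r ^ N * real N" .
      then have "r ^ N * (r * (real N * r ^ (N - 1))) * T F \<alpha> z r = r ^ N * (r ^ N * real N) * T F \<alpha> z r"
        by (simp only:)
      then show ?thesis unfolding zT[symmetric] power_Suc by (simp only: mult_ac)
    qed
    have "(r ^ N * integrand F \<alpha> z r) * r ^ N - (r ^ Suc N * T F \<alpha> z r) * (real N * r ^ (N - 1))
       = (r ^ N * r ^ N) * H (z r) (F (radial_v \<alpha> z r))"
      unfolding e by (simp add: integrand_def algebra_simps)
    then show ?thesis using r by simp
  qed
  ultimately have "((\<lambda>r. (r ^ Suc N * T F \<alpha> z r) / r ^ N) has_real_derivative H (z r) (F (radial_v \<alpha> z r))) (at r)"
    by simp
  then show ?thesis
    by (rule has_field_derivative_transform_within_open[where S = "{0<..}"])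
      (use r in \<open>auto simp: zT[symmetric]\<close>)
qed

text \<open>At the origin \<open>T\<close> averages a constant against t^N and the shift cancels.
  Thus v'' and v'/r agree there, the compatibility condition for a continuous Hessian.\<close>

lemma sol_at_0:
  assumes z: "sol F \<alpha> z"
  shows "H (z 0) (F \<alpha>) = z 0"
proof -
  have "z 0 = T F \<alpha> z 0" using z by (simp add: sol_def)
  also have "\<dots> = (H (z 0) (F \<alpha>) + real N * z 0) / (real N + 1)"
    using integral_unique[OF has_integral_mult_left[OF has_integral_power_01[of N], of "H (z 0) (F \<alpha>) + real N * z 0"]]
    by (simp add: T_def integrand_def)
  finally show ?thesis by (simp add: field_simps)
qed

end

section \<open>Comparison and uniqueness\<close>

text \<open>After the last point before r with y \<le> 0 the function is positive, hence
  nonincreasing, so it cannot have risen above 0.\<close>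

lemma nonpos_if_deriv_nonpos_where_pos:
  fixes y y' :: "real \<Rightarrow> real"
  assumes cont: "continuous_on {0..\<rho>} y" and y0: "y 0 \<le> 0"
    and deriv: "\<And>x. \<lbrakk>0 < x; x < \<rho>\<rbrakk> \<Longrightarrow> (y has_real_derivative y' x) (at x)"
    and le: "\<And>x. \<lbrakk>0 < x; x < \<rho>; y x > 0\<rbrakk> \<Longrightarrow> y' x \<le> 0"
    and r: "r \<in> {0..\<rho>}"
  shows "y r \<le> 0"
proof (rule ccontr)
  assume neg: "\<not> y r \<le> 0"
  define S where "S = {x \<in> {0..r}. y x \<le> 0}"
  have cr: "continuous_on {0..r} y" using cont r by (auto intro: continuous_on_subset)
  have "closed S" unfolding S_def
    by (intro continuous_on_closed_Collect_le cr continuous_intros)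
  moreover have "0 \<in> S" "bdd_above S" using y0 r by (auto simp: S_def)
  ultimately have "Sup S \<in> S" by (intro closed_contains_Sup) auto
  define c where "c = Sup S"
  have c: "0 \<le> c" "c \<le> r" "y c \<le> 0" using \<open>Sup S \<in> S\<close> by (auto simp: c_def S_def)
  have pos: "y x > 0" if "c < x" "x \<le> r" for x
  proof (rule ccontr)
    assume "\<not> y x > 0"
    then have "x \<in> S" using that c by (auto simp: S_def)
    then have "x \<le> c" unfolding c_def using \<open>bdd_above S\<close> by (rule cSup_upper)
    with that show False by simp
  qed
  have "y r \<le> y c"
  proof (rule DERIV_nonpos_imp_decreasing_open[where f = y and a = c and b = r])
    fix x assume x: "c < x" "x < r"
    then show "\<exists>d. (y has_real_derivative d) (at x) \<and> d \<le> 0"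
      using deriv[of x] le[of x] pos[of x] c r by auto
  qed (use c cr in \<open>auto intro: continuous_on_subset\<close>)
  with c neg show False by simp
qed

lemma deriv_le_imp_le:
  fixes f g :: "real \<Rightarrow> real"
  assumes "a \<le> b" "f a \<le> g a"
    and "\<And>x. \<lbrakk>a \<le> x; x \<le> b\<rbrakk> \<Longrightarrow> (f has_real_derivative f' x) (at x)"
    and "\<And>x. \<lbrakk>a \<le> x; x \<le> b\<rbrakk> \<Longrightarrow> (g has_real_derivative g' x) (at x)"
    and "\<And>x. \<lbrakk>a \<le> x; x \<le> b\<rbrakk> \<Longrightarrow> f' x \<le> g' x"
  shows "f b \<le> g b"
proof -
  have "g a - f a \<le> g b - f b"
  proof (rule DERIV_nonneg_imp_nondecreasing[OF assms(1)])
    fix x assume x: "a \<le> x" "x \<le> b"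
    show "\<exists>y. ((\<lambda>x. g x - f x) has_real_derivative y) (at x) \<and> 0 \<le> y"
      using DERIV_diff[OF assms(4)[OF x] assms(3)[OF x]] assms(5)[OF x] by force
  qed
  then show ?thesis using assms(2) by simp
qed

text \<open>Composition with this projection makes a function that is Lipschitz on [0, K] globally
  Lipschitz, and continues it to negative arguments by its value at 0.\<close>

definition clip :: "real \<Rightarrow> real \<Rightarrow> real" where "clip K t = max 0 (min K t)"

lemma clip_range: "K \<ge> 0 \<Longrightarrow> clip K t \<in> {0..K}"
  by (auto simp: clip_def)

lemma clip_id: "t \<in> {0..K} \<Longrightarrow> clip K t = t"
  by (auto simp: clip_def)

lemma clip_lipschitz: "\<bar>clip K s - clip K t\<bar> \<le> \<bar>s - t\<bar>"
  unfolding clip_def by linarith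

lemma clip_scale: "\<alpha> > 0 \<Longrightarrow> clip (\<alpha> * M) (\<alpha> * t) = \<alpha> * clip M t"
  by (auto simp: clip_def max_def min_def mult_le_0_iff zero_le_mult_iff)

lemma lipschitz_clip:
  assumes "L-lipschitz_on {0..K} F" "K \<ge> 0"
  shows "L-lipschitz_on UNIV (\<lambda>t. F (clip K t))"
proof (rule lipschitz_onI)
  show "L \<ge> 0" using assms(1) by (rule lipschitz_on_nonneg)
  fix s t :: real
  have "dist (F (clip K s)) (F (clip K t)) \<le> L * dist (clip K s) (clip K t)"
    using clip_range[OF assms(2)] by (intro lipschitz_onD[OF assms(1)])
  also have "\<dots> \<le> L * dist s t"
    using \<open>L \<ge> 0\<close> clip_lipschitz by (intro mult_left_mono) (auto simp: dist_real_def)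
  finally show "dist (F (clip K s)) (F (clip K t)) \<le> L * dist s t" .
qed

section \<open>Comparison and growth of radial solutions\<close>

context radial_pucci begin

lemma continuous_on_sol: "sol F \<alpha> z \<Longrightarrow> continuous_on S z"
  unfolding sol_def using continuous_on_subset by blast

lemma sol_radial_v_deriv: "sol F \<alpha> z \<Longrightarrow> (radial_v \<alpha> z has_real_derivative r * z r) (at r within S)"
  unfolding sol_def by (blast intro: radial_v_deriv)

lemma continuous_on_sol_radial_v: "sol F \<alpha> z \<Longrightarrow> continuous_on S (radial_v \<alpha> z)"
  using continuous_on_radial_v continuous_on_subset unfolding sol_def by blast

text \<open>Where v' > 0, also z > 0, and both terms of m(v'') = - \<nu> m(z) - F(v) are
  nonpositive, so v'' \<le> 0. Starting from 0, v' never becomes positive.\<close>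

lemma radial_v_le_initial:
  assumes z: "sol F \<alpha> z" and F: "continuous_on UNIV F" "\<And>t. F t \<ge> 0" and r: "r \<ge> 0"
  shows "radial_v \<alpha> z r \<le> \<alpha>"
proof -
  have *: "s * z s \<le> 0" if "s \<ge> 0" for s
  proof (rule nonpos_if_deriv_nonpos_where_pos[where \<rho> = s and y = "\<lambda>s. s * z s" and y' = "\<lambda>r. H (z r) (F (radial_v \<alpha> z r))"])
    show "continuous_on {0..s} (\<lambda>s. s * z s)" by (intro continuous_intros continuous_on_sol[OF z])
    fix x assume x: "0 < x" "x < s"
    then show "((\<lambda>s. s * z s) has_real_derivative H (z x) (F (radial_v \<alpha> z x))) (at x)"
      by (intro sol_ode[OF z F(1)])
    assume "0 < x * z x"
    then have "m (z x) \<ge> 0" using x m_sgn by (simp add: zero_less_mult_iff)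
    then have "0 \<le> \<nu> * m (z x)" using \<nu>_nonneg by simp
    then have "- \<nu> * m (z x) - F (radial_v \<alpha> z x) \<le> 0" using F(2)[of "radial_v \<alpha> z x"] by simp
    then show "H (z x) (F (radial_v \<alpha> z x)) \<le> 0" unfolding H_def m_inv_sgn .
  qed (use that in auto)
  have "radial_v \<alpha> z r \<le> radial_v \<alpha> z 0"
    using * by (intro DERIV_nonpos_imp_nonincreasing[OF r]) (blast intro: sol_radial_v_deriv[OF z])
  then show ?thesis by simp
qed

text \<open>The mirror image of the previous comparison; it settles the linear problem with a
  nonpositive coefficient.\<close>

lemma radial_v_ge_initial:
  assumes z: "sol F \<alpha> z" and F: "continuous_on UNIV F" "\<And>t. F t \<le> 0" and r: "r \<ge> 0"
  shows "radial_v \<alpha> z r \<ge> \<alpha>"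
proof -
  have *: "- (s * z s) \<le> 0" if "s \<ge> 0" for s
  proof (rule nonpos_if_deriv_nonpos_where_pos[where \<rho> = s and y = "\<lambda>s. - (s * z s)" and y' = "\<lambda>r. - H (z r) (F (radial_v \<alpha> z r))"])
    show "continuous_on {0..s} (\<lambda>s. - (s * z s))" by (intro continuous_intros continuous_on_sol[OF z])
    fix x assume x: "0 < x" "x < s"
    then show "((\<lambda>s. - (s * z s)) has_real_derivative - H (z x) (F (radial_v \<alpha> z x))) (at x)"
      by (intro DERIV_minus sol_ode[OF z F(1)])
    assume "0 < - (x * z x)"
    then have "m (z x) \<le> 0" using x m_sgn by (simp add: mult_less_0_iff)
    then have "\<nu> * m (z x) \<le> 0" using \<nu>_nonneg by (simp add: mult_le_0_iff)
    then have "- \<nu> * m (z x) - F (radial_v \<alpha> z x) \<ge> 0" using F(2)[of "radial_v \<alpha> z x"] by simp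
    then show "- H (z x) (F (radial_v \<alpha> z x)) \<le> 0" unfolding H_def neg_le_0_iff_le m_inv_sgn .
  qed (use that in auto)
  have "radial_v \<alpha> z 0 \<le> radial_v \<alpha> z r"
    using * by (intro DERIV_nonneg_imp_nondecreasing[OF r]) (force intro: sol_radial_v_deriv[OF z])
  then show ?thesis by simp
qed

text \<open>An exponent k with k \<ge> 1 and k^2 \<ge> 2 \<gamma> / \<open>ell\<close>: integrating
  \<gamma> / \<open>ell\<close> times exp(k r) twice then costs a factor of at most 1/2.\<close>

definition growth :: "real \<Rightarrow> real" where "growth \<gamma> = 1 + 2 * (\<gamma> / ell)"

text \<open>Where v' > 0 the first-order term only lowers v'', so v'' is at most \<gamma> /
  \<open>ell\<close> times the positive part of v. With A the maximum of exp(- k r) v on [0, R], two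
  integrations give A \<le> \<alpha> + A / 2. The bound is linear in \<alpha>, which lets the
  truncation scale with the initial value.\<close>

lemma radial_v_growth:
  assumes z: "sol F \<alpha> z" and Fc: "continuous_on UNIV F"
    and F: "\<And>t. F t \<ge> - \<gamma> * max t 0" and \<gamma>: "\<gamma> \<ge> 0" and \<alpha>: "\<alpha> > 0" and r: "r \<in> {0..R}"
  shows "radial_v \<alpha> z r \<le> 2 * exp (growth \<gamma> * R) * \<alpha>"
proof -
  define C where "C = \<gamma> / ell"
  define k where "k = growth \<gamma>"
  have C: "C \<ge> 0" using \<gamma> ell_pos by (simp add: C_def)
  have k: "k \<ge> 1" "2 * C \<le> k\<^sup>2" "k > 0"
    using C by (auto simp: k_def growth_def C_def[symmetric] power2_eq_square algebra_simps)
  let ?v = "radial_v \<alpha> z"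
  let ?h = "\<lambda>s. exp (- k * s) * ?v s"
  have "continuous_on {0..R} ?h" by (intro continuous_intros continuous_on_sol_radial_v[OF z])
  then obtain x where x: "x \<in> {0..R}" and xmax: "\<And>y. y \<in> {0..R} \<Longrightarrow> ?h y \<le> ?h x"
    using continuous_attains_sup[of "{0..R}" ?h] r by force
  define A where "A = ?h x"
  have A0: "A > 0" using xmax[of 0] r \<alpha> by (auto simp: A_def)
  have vA: "?v s \<le> A * exp (k * s)" if "s \<in> {0..R}" for s
    using xmax[OF that] unfolding A_def[symmetric] by (simp add: exp_minus field_simps)
  have bound: "s * z s \<le> C * A / k * exp (k * s)" if s: "s \<in> {0..R}" for s
  proof -
    have "s * z s - C * A / k * exp (k * s) \<le> 0"
    proof (rule nonpos_if_deriv_nonpos_where_pos[where \<rho> = R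
          and y = "\<lambda>s. s * z s - C * A / k * exp (k * s)" and y' = "\<lambda>r. H (z r) (F (?v r)) - C * A * exp (k * r)"])
      show "continuous_on {0..R} (\<lambda>s. s * z s - C * A / k * exp (k * s))"
        by (intro continuous_intros continuous_on_sol[OF z])
      show "0 * z 0 - C * A / k * exp (k * 0) \<le> 0" using C A0 k by simp
      fix t assume t: "0 < t" "t < R"
      have "((\<lambda>s. C * A / k * exp (k * s)) has_real_derivative C * A * exp (k * t)) (at t)"
        using k by (auto intro!: derivative_eq_intros)
      from DERIV_diff[OF sol_ode[OF z Fc t(1)] this]
      show "((\<lambda>s. s * z s - C * A / k * exp (k * s)) has_real_derivative H (z t) (F (?v t)) - C * A * exp (k * t)) (at t)" .
      assume "t * z t - C * A / k * exp (k * t) > 0"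
      moreover have "C * A / k * exp (k * t) \<ge> 0" using C A0 k by simp
      ultimately have "t * z t > 0" by linarith
      then have "z t \<ge> 0" using t by (simp add: zero_less_mult_iff)
      then have "H (z t) (F (?v t)) \<le> H 0 (F (?v t))" by (rule H_antimono_left)
      also have "\<dots> = m_inv (- F (?v t))" by (simp add: H_def)
      also have "\<dots> \<le> m_inv (\<gamma> * max (?v t) 0)" using m_inv_diff(1)[of "- F (?v t)"] F[of "?v t"] by simp
      also have "\<dots> \<le> \<gamma> * max (?v t) 0 / ell"
        using m_inv_diff(2)[of 0 "\<gamma> * max (?v t) 0"] \<gamma> by simp
      also have "\<dots> = C * max (?v t) 0" by (simp add: C_def)
      also have "\<dots> \<le> C * (A * exp (k * t))"
        using C A0 vA[of t] t by (intro mult_left_mono) auto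
      finally show "H (z t) (F (?v t)) - C * A * exp (k * t) \<le> 0" by simp
    qed (use s in auto)
    then show ?thesis by simp
  qed
  have "?v x \<le> \<alpha> + C * A / k\<^sup>2 * exp (k * x)"
  proof (rule deriv_le_imp_le[where a = 0 and b = x and f = ?v and
        g = "\<lambda>s. \<alpha> + C * A / k\<^sup>2 * exp (k * s)" and f' = "\<lambda>s. s * z s" and g' = "\<lambda>s. C * A / k * exp (k * s)"])
    show "?v 0 \<le> \<alpha> + C * A / k\<^sup>2 * exp (k * 0)" using C A0 by simp
    fix s
    show "((\<lambda>x. \<alpha> + C * A / k\<^sup>2 * exp (k * x)) has_real_derivative C * A / k * exp (k * s)) (at s)"
      using k by (auto intro!: derivative_eq_intros simp: power2_eq_square field_simps)
  qed (use x bound in \<open>auto intro: sol_radial_v_deriv[OF z]\<close>)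
  then have "A \<le> exp (- k * x) * (\<alpha> + C * A / k\<^sup>2 * exp (k * x))"
    unfolding A_def by (intro mult_left_mono) auto
  also have "\<dots> = exp (- k * x) * \<alpha> + C * A / k\<^sup>2"
    by (simp add: algebra_simps exp_minus)
  also have "\<dots> \<le> \<alpha> + A / 2"
  proof (intro add_mono)
    have "exp (- k * x) \<le> 1" using k x by simp
    then show "exp (- k * x) * \<alpha> \<le> \<alpha>" using \<alpha> by simp
    have "2 * C * A \<le> k\<^sup>2 * A" using k A0 by (intro mult_right_mono) auto
    then show "C * A / k\<^sup>2 \<le> A / 2" using k by (simp add: field_simps)
  qed
  finally have A2: "A \<le> 2 * \<alpha>" by simp
  have "?v r \<le> A * exp (k * r)" by (rule vA[OF r])
  also have "\<dots> \<le> 2 * \<alpha> * exp (k * R)"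
    by (rule mult_mono[OF A2]) (use r k \<alpha> in auto)
  finally show ?thesis by (simp add: k_def mult_ac)
qed

text \<open>Backward uniqueness: away from \<open>r = 0\<close> the equation is regular, so \<open>v\<^sup>2 + (v')\<^sup>2\<close> satisfies a
  Gronwall inequality.\<close>

lemma sol_no_double_zero:
  assumes z: "sol F \<alpha> z" and F: "K-lipschitz_on UNIV F" and F0: "F 0 = 0"
    and r: "r > 0" and zero: "radial_v \<alpha> z r = 0" "z r = 0"
  shows "\<alpha> = 0"
proof -
  have K: "K \<ge> 0" using F by (rule lipschitz_on_nonneg)
  have Fc: "continuous_on UNIV F" using F by (rule lipschitz_on_continuous_on)
  let ?v = "radial_v \<alpha> z"
  let ?y = "\<lambda>s. s * z s"
  have v0: "?v e = 0" if e: "0 < e" "e \<le> r" for e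
  proof -
    \<comment> \<open>On [e, r] the singular coefficient is at most N / e, so |v''| \<le> (N / e)
      |v'| + (K / ell) |v|. \<open>B\<close> absorbs this and the cross term 2 v v', so the weighted
      energy is nondecreasing towards r, where it vanishes.\<close>
    define B where "B = 1 + 2 * (real N / e) + K / ell"
    let ?E = "\<lambda>s. ((?v s)\<^sup>2 + (?y s)\<^sup>2) * exp (B * s)"
    have "?E e \<le> ?E r"
    proof (rule DERIV_nonneg_imp_nondecreasing[OF e(2)])
      fix s assume s: "e \<le> s" "s \<le> r"
      then have s0: "s > 0" using e by simp
      define h where "h = H (z s) (F (?v s))"
      have "((?E) has_real_derivative
          (2 * ?v s * ?y s + 2 * ?y s * h) * exp (B * s) + ((?v s)\<^sup>2 + (?y s)\<^sup>2) * (B * exp (B * s))) (at s)"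
        unfolding h_def
        by (rule derivative_eq_intros sol_radial_v_deriv[OF z] sol_ode[OF z Fc s0] refl)+
          (simp add: algebra_simps)
      moreover have "(2 * ?v s * ?y s + 2 * ?y s * h) * exp (B * s) + ((?v s)\<^sup>2 + (?y s)\<^sup>2) * (B * exp (B * s)) \<ge> 0"
      proof -
        have "\<bar>h\<bar> \<le> real N * \<bar>z s\<bar> + \<bar>F (?v s)\<bar> / ell"
          using H_lipschitz_left[of "z s" "F (?v s)" 0] H_lipschitz_right[of 0 "F (?v s)" 0]
          unfolding h_def by (simp add: H_def)
        also have "\<dots> \<le> real N / e * \<bar>?y s\<bar> + K / ell * \<bar>?v s\<bar>"
        proof (rule add_mono)
          have "e * \<bar>z s\<bar> \<le> \<bar>?y s\<bar>" using s s0 by (simp add: abs_mult mult_right_mono)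
          then have "real N * (e * \<bar>z s\<bar>) \<le> real N * \<bar>?y s\<bar>" by (rule mult_left_mono) simp
          then show "real N * \<bar>z s\<bar> \<le> real N / e * \<bar>?y s\<bar>" using e(1) by (simp add: field_simps)
          have "\<bar>F (?v s)\<bar> \<le> K * \<bar>?v s\<bar>"
            using lipschitz_onD[OF F, of "?v s" 0] F0 by (simp add: dist_real_def)
          then show "\<bar>F (?v s)\<bar> / ell \<le> K / ell * \<bar>?v s\<bar>" using ell_pos by (simp add: divide_right_mono)
        qed
        finally have hb: "\<bar>h\<bar> \<le> real N / e * \<bar>?y s\<bar> + K / ell * \<bar>?v s\<bar>" .
        define p q c d where "p = \<bar>?v s\<bar>" and "q = \<bar>?y s\<bar>" and "c = real N / e" and "d = K / ell"
        have nn: "p \<ge> 0" "q \<ge> 0" "c \<ge> 0" "d \<ge> 0" using e K ell_pos by (auto simp: p_def q_def c_def d_def)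
        have "\<bar>2 * ?v s * ?y s + 2 * ?y s * h\<bar> \<le> 2 * p * q + 2 * q * \<bar>h\<bar>"
          unfolding p_def q_def by (rule order_trans[OF abs_triangle_ineq]) (simp add: abs_mult)
        also have "\<dots> \<le> 2 * p * q + 2 * q * (c * q + d * p)"
          using hb nn unfolding p_def q_def c_def d_def by (intro add_left_mono mult_left_mono) auto
        also have "\<dots> = (1 + d) * (2 * p * q) + 2 * c * q\<^sup>2" by (simp add: power2_eq_square algebra_simps)
        also have "\<dots> \<le> (1 + d) * (p\<^sup>2 + q\<^sup>2) + 2 * c * (p\<^sup>2 + q\<^sup>2)"
          using nn sum_squares_bound[of p q] by (intro add_mono mult_left_mono) auto
        also have "\<dots> = B * ((?v s)\<^sup>2 + (?y s)\<^sup>2)"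
          by (simp add: B_def c_def d_def p_def q_def algebra_simps power2_abs del: power_mult_distrib)
        finally have "0 \<le> (2 * ?v s * ?y s + 2 * ?y s * h) + B * ((?v s)\<^sup>2 + (?y s)\<^sup>2)" by linarith
        then have "0 \<le> ((2 * ?v s * ?y s + 2 * ?y s * h) + B * ((?v s)\<^sup>2 + (?y s)\<^sup>2)) * exp (B * s)" by simp
        then show ?thesis by (simp add: algebra_simps)
      qed
      ultimately show "\<exists>d. (?E has_real_derivative d) (at s) \<and> 0 \<le> d" by blast
    qed
    also have "\<dots> = 0" using zero by simp
    finally have "(?v e)\<^sup>2 + (?y e)\<^sup>2 \<le> 0" by (simp add: mult_le_0_iff)
    then show ?thesis by (simp add: sum_power2_le_zero_iff)
  qed
  \<comment> \<open>The energy argument covers only positive radii. Continuity carries the value 0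
    to the origin, where v equals \<alpha>.\<close>
  have "(?v \<longlongrightarrow> ?v 0) (at 0 within {0<..})"
    using continuous_on_sol_radial_v[OF z, of UNIV] unfolding continuous_on_def
    by (blast intro: tendsto_within_subset)
  moreover have "(?v \<longlongrightarrow> 0) (at 0 within {0<..})"
  proof (rule tendsto_eventually)
    show "\<forall>\<^sub>F x in at_right 0. ?v x = 0"
      unfolding eventually_at_right_field using r v0 by (intro exI[of _ r]) auto
  qed
  ultimately have "?v 0 = 0" by (intro tendsto_unique[OF trivial_limit_at_right_real])
  then show ?thesis by simp
qed

end

section \<open>Shooting\<close>

lemma lipschitz_powr:
  assumes "p > 1" "M \<ge> 0"
  shows "(p * M powr (p - 1))-lipschitz_on {0..M} (\<lambda>t. t powr p)"
proof -
  have *: "\<bar>t powr p - s powr p\<bar> \<le> p * M powr (p - 1) * (t - s)" if st: "0 \<le> s" "s < t" "t \<le> M" for s t :: real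
  proof -
    have "continuous_on {s..t} (\<lambda>t. t powr p)"
      using st assms by (intro continuous_on_powr' continuous_intros) auto
    then obtain l x where x: "s < x" "x < t" "((\<lambda>t. t powr p) has_real_derivative l) (at x)"
      and eq: "t powr p - s powr p = (t - s) * l"
      using MVT[of s t "\<lambda>t. t powr p"] st
      by (metis (no_types, lifting) has_real_derivative_powr real_differentiable_def order_le_less_trans)
    have "l = p * x powr (p - 1)"
      using DERIV_unique[OF x(3) has_real_derivative_powr] x st by simp
    moreover have "x powr (p - 1) \<le> M powr (p - 1)"
      using x st assms by (intro powr_mono2) auto
    ultimately have "0 \<le> l" "l \<le> p * M powr (p - 1)" using assms by auto
    then show ?thesis unfolding eq using st by (simp add: abs_mult mult.commute mult_right_mono)
  qed
  show ?thesis
  proof (rule lipschitz_onI)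
    fix s t assume "s \<in> {0..M}" "t \<in> {0..M}"
    then show "dist (s powr p) (t powr p) \<le> p * M powr (p - 1) * dist s t"
      using *[of s t] *[of t s] by (cases s t rule: linorder_cases) (auto simp: dist_real_def abs_minus_commute)
  qed (use assms in simp)
qed

text \<open>Split at a threshold t1. Above it the relative error \<delta> of the limit becomes at
  most \<delta> M^p after rescaling, which is \<epsilon> / 2; below it the error is bounded by some
  D, and D \<alpha>^(-p) tends to 0.\<close>

lemma rescaled_power_limit:
  fixes F :: "real \<Rightarrow> real"
  assumes F: "continuous_on {0..} F" and lim: "((\<lambda>t. F t / t powr p) \<longlongrightarrow> C) at_top"
    and p: "p > 0" and M: "M > 0" and \<epsilon>: "\<epsilon> > 0"
  shows "\<forall>\<^sub>F \<alpha> in at_top. \<forall>s\<in>{0..M}. \<bar>\<alpha> powr (- p) * F (\<alpha> * s) - C * s powr p\<bar> \<le> \<epsilon>"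
proof -
  define \<delta> where "\<delta> = \<epsilon> / (2 * M powr p)"
  have \<delta>: "\<delta> > 0" using \<epsilon> M by (simp add: \<delta>_def)
  have "\<forall>\<^sub>F t in at_top. dist (F t / t powr p) C < \<delta>" using lim \<delta> by (rule tendstoD)
  then obtain t0 where t0: "\<And>t. t \<ge> t0 \<Longrightarrow> dist (F t / t powr p) C < \<delta>"
    unfolding eventually_at_top_linorder by auto
  define t1 where "t1 = max t0 1"
  have big: "\<bar>F t - C * t powr p\<bar> \<le> \<delta> * t powr p" if "t \<ge> t1" for t
  proof -
    have tp: "t powr p > 0" using that by (simp add: t1_def)
    then have "\<bar>F t - C * t powr p\<bar> = \<bar>F t / t powr p - C\<bar> * t powr p"
      by (simp add: abs_mult_pos left_diff_distrib)
    also have "\<dots> \<le> \<delta> * t powr p"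
      using t0[of t] that tp by (intro mult_right_mono) (auto simp: dist_real_def t1_def)
    finally show ?thesis .
  qed
  have "continuous_on {0..t1} (\<lambda>t. \<bar>F t - C * t powr p\<bar>)"
    using p by (intro continuous_intros continuous_on_powr' continuous_on_subset[OF F]) auto
  then have "\<exists>D. \<forall>t\<in>{0..t1}. \<bar>F t - C * t powr p\<bar> \<le> D"
    using continuous_attains_sup[of "{0..t1}" "\<lambda>t. \<bar>F t - C * t powr p\<bar>"] by (force simp: t1_def)
  then obtain D where D: "\<And>t. t \<in> {0..t1} \<Longrightarrow> \<bar>F t - C * t powr p\<bar> \<le> D" by blast
  have D0: "D \<ge> 0" using order_trans[OF abs_ge_zero D[of t1]] by (simp add: t1_def)
  have "((\<lambda>\<alpha>. D * \<alpha> powr (- p)) \<longlongrightarrow> D * 0) at_top"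
    using p by (intro tendsto_intros tendsto_neg_powr filterlim_ident) auto
  then have "\<forall>\<^sub>F \<alpha> in at_top. D * \<alpha> powr (- p) < \<epsilon> / 2"
    using \<epsilon> by (intro order_tendstoD) auto
  then show ?thesis using eventually_gt_at_top[of 0]
  proof eventually_elim
    case (elim \<alpha>)
    show ?case
    proof
      fix s assume s: "s \<in> {0..M}"
      have sp: "(\<alpha> * s) powr p = \<alpha> powr p * s powr p" using elim s by (simp add: powr_mult)
      have "\<alpha> powr (- p) * F (\<alpha> * s) - C * s powr p = \<alpha> powr (- p) * (F (\<alpha> * s) - C * (\<alpha> * s) powr p)"
        unfolding sp using elim by (simp add: algebra_simps powr_minus)
      then have "\<bar>\<alpha> powr (- p) * F (\<alpha> * s) - C * s powr p\<bar> = \<alpha> powr (- p) * \<bar>F (\<alpha> * s) - C * (\<alpha> * s) powr p\<bar>"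
        by (simp add: abs_mult)
      also have "\<dots> \<le> \<alpha> powr (- p) * (\<delta> * (\<alpha> * s) powr p + D)"
      proof (intro mult_left_mono)
        show "\<bar>F (\<alpha> * s) - C * (\<alpha> * s) powr p\<bar> \<le> \<delta> * (\<alpha> * s) powr p + D"
        proof (cases "\<alpha> * s \<ge> t1")
          case True then show ?thesis using big[of "\<alpha> * s"] D0 by simp
        next
          case False
          have "0 \<le> \<delta> * (\<alpha> * s) powr p" using \<delta> by simp
          then show ?thesis using D[of "\<alpha> * s"] elim s False by auto
        qed
      qed simp
      also have "\<dots> = \<delta> * s powr p + D * \<alpha> powr (- p)"
        unfolding sp using elim by (simp add: algebra_simps powr_minus)
      also have "\<dots> \<le> \<delta> * M powr p + \<epsilon> / 2"
        using elim s p \<delta> by (intro add_mono mult_left_mono powr_mono2) auto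
      also have "\<dots> = \<epsilon>" using M by (simp add: \<delta>_def)
      finally show "\<bar>\<alpha> powr (- p) * F (\<alpha> * s) - C * s powr p\<bar> \<le> \<epsilon>" .
    qed
  qed
qed

context radial_pucci begin

text \<open>Sensitivity on [0, \<rho>] to an error in the nonlinearity. For a given operator it
  depends on K and \<rho> only, hence is uniform over the rescaled families below.\<close>

definition stab :: "real \<Rightarrow> real \<Rightarrow> real" where
  "stab K \<rho> = 2 * (real N + 1) / ell * exp (rate K * \<rho>\<^sup>2) / (2 * rate K)"

lemma stab_pos: "K \<ge> 0 \<Longrightarrow> stab K \<rho> > 0"
  using rate(1)[of K] ell_pos unfolding stab_def by (intro divide_pos_pos mult_pos_pos) auto

lemma radial_v_stability:
  assumes "sol F \<alpha> z" "sol G \<beta> w" "K-lipschitz_on UNIV F" "continuous_on UNIV G"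
    and "\<And>r. r \<in> {0..\<rho>} \<Longrightarrow> \<bar>F (radial_v \<beta> w r) - G (radial_v \<beta> w r)\<bar> \<le> \<epsilon>"
    and "r \<in> {0..\<rho>}"
  shows "\<bar>radial_v \<alpha> z r - radial_v \<beta> w r\<bar> \<le> \<bar>\<alpha> - \<beta>\<bar> + stab K \<rho> * (\<epsilon> + K * \<bar>\<alpha> - \<beta>\<bar>)"
  using stability[OF assms] by (simp add: stab_def mult_ac)

lemma shooting:
  assumes F: "K-lipschitz_on UNIV F" and F0: "F 0 = 0" and R: "R > 0" and \<alpha>: "0 < \<alpha>0" "\<alpha>0 \<le> \<alpha>1"
    and small: "\<And>z r. sol F \<alpha>0 z \<Longrightarrow> r \<in> {0..R} \<Longrightarrow> radial_v \<alpha>0 z r > 0"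
    and large: "sol F \<alpha>1 z1" "r1 \<in> {0..R}" "radial_v \<alpha>1 z1 r1 \<le> 0"
  obtains \<alpha> z where "\<alpha>0 \<le> \<alpha>" "\<alpha> \<le> \<alpha>1" "sol F \<alpha> z"
    "\<And>r. \<lbrakk>0 \<le> r; r < R\<rbrakk> \<Longrightarrow> radial_v \<alpha> z r > 0" "radial_v \<alpha> z R = 0"
proof -
  have K: "K \<ge> 0" using F by (rule lipschitz_on_nonneg)
  have Fc: "continuous_on UNIV F" using F by (rule lipschitz_on_continuous_on)
  obtain Z where Z: "\<And>\<alpha>. sol F \<alpha> (Z \<alpha>)" using sol_exists[OF F] by metis
  define C where "C = 1 + stab K R * K"
  have C: "C \<ge> 0" using stab_pos[OF K, of R] K by (simp add: C_def)
  have dep: "\<bar>radial_v \<alpha> z r - radial_v \<beta> w r\<bar> \<le> C * \<bar>\<alpha> - \<beta>\<bar>"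
    if "sol F \<alpha> z" "sol F \<beta> w" "r \<in> {0..R}" for \<alpha> \<beta> z w r
    using radial_v_stability[OF that(1,2) F Fc, of R 0 r] that(3) by (simp add: C_def algebra_simps)
  define V where "V = (\<lambda>\<alpha>. radial_v \<alpha> (Z \<alpha>))"
  have Vc: "continuous_on {0..R} (V \<alpha>)" for \<alpha> unfolding V_def by (rule continuous_on_sol_radial_v[OF Z])
  have att: "\<exists>x\<in>{0..R}. \<forall>r\<in>{0..R}. V \<alpha> x \<le> V \<alpha> r" for \<alpha>
    using continuous_attains_inf[OF _ _ Vc, of \<alpha>] R by auto
  then obtain X where X: "\<And>\<alpha>. X \<alpha> \<in> {0..R}" "\<And>\<alpha> r. r \<in> {0..R} \<Longrightarrow> V \<alpha> (X \<alpha>) \<le> V \<alpha> r"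
    by metis
  define \<mu> where "\<mu> = (\<lambda>\<alpha>. V \<alpha> (X \<alpha>))"
  \<comment> \<open>The minimum for \<alpha> is at most the value at a minimiser for \<beta>, so the
    minimum is Lipschitz in the parameter even if the minimiser jumps.\<close>
  have \<mu>_le: "\<mu> \<alpha> \<le> \<mu> \<beta> + C * \<bar>\<alpha> - \<beta>\<bar>" for \<alpha> \<beta>
    using X(2)[OF X(1), of \<alpha> \<beta>] dep[OF Z Z X(1), of \<alpha> \<beta> \<beta>] unfolding \<mu>_def V_def by linarith
  have "C-lipschitz_on {\<alpha>0..\<alpha>1} \<mu>"
  proof (rule lipschitz_onI)
    fix \<alpha> \<beta> show "dist (\<mu> \<alpha>) (\<mu> \<beta>) \<le> C * dist \<alpha> \<beta>"
      using \<mu>_le[of \<alpha> \<beta>] \<mu>_le[of \<beta> \<alpha>] by (simp add: dist_real_def abs_minus_commute abs_le_iff)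
  qed (rule C)
  then have "continuous_on {\<alpha>0..\<alpha>1} \<mu>" by (rule lipschitz_on_continuous_on)
  moreover have "0 \<le> \<mu> \<alpha>0" using small[OF Z X(1)] by (simp add: \<mu>_def V_def less_imp_le)
  \<comment> \<open>\<open>z1\<close> may differ from the chosen solution
    \<open>Z \<alpha>1\<close>; \<open>dep\<close> with equal initial values shows that their
    profiles coincide on [0, R].\<close>
  moreover have "\<mu> \<alpha>1 \<le> 0"
    using X(2)[OF large(2), of \<alpha>1] dep[OF Z large(1,2), of \<alpha>1] large(3) unfolding \<mu>_def V_def by simp
  ultimately obtain \<alpha> where a: "\<alpha>0 \<le> \<alpha>" "\<alpha> \<le> \<alpha>1" "\<mu> \<alpha> = 0"
    using IVT2'[of \<mu> \<alpha>1 0 \<alpha>0] \<alpha> by auto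
  have nonneg: "V \<alpha> r \<ge> 0" if "r \<in> {0..R}" for r using X(2)[OF that, of \<alpha>] a by (simp add: \<mu>_def)
  have pos: "V \<alpha> r > 0" if r: "0 \<le> r" "r < R" for r
  proof (rule ccontr)
    assume "\<not> V \<alpha> r > 0"
    then have v0: "V \<alpha> r = 0" using nonneg[of r] r by auto
    have r0: "r > 0" using v0 r \<alpha> a by (cases "r = 0") (auto simp: V_def)
    have "r * Z \<alpha> r = 0"
    proof (rule DERIV_local_min[where f = "V \<alpha>" and x = r and d = "min r (R - r)"])
      show "(V \<alpha> has_real_derivative r * Z \<alpha> r) (at r)" unfolding V_def by (rule sol_radial_v_deriv[OF Z])
      show "\<forall>y. \<bar>r - y\<bar> < min r (R - r) \<longrightarrow> V \<alpha> r \<le> V \<alpha> y"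
      proof (intro allI impI)
        fix y assume "\<bar>r - y\<bar> < min r (R - r)"
        then have "y \<in> {0..R}" by (simp add: abs_less_iff)
        then show "V \<alpha> r \<le> V \<alpha> y" using v0 nonneg by simp
      qed
    qed (use r0 r in auto)
    then have "Z \<alpha> r = 0" using r0 by simp
    with v0 have "\<alpha> = 0" unfolding V_def by (rule sol_no_double_zero[OF Z F F0 r0])
    then show False using \<alpha> a by simp
  qed
  have "X \<alpha> = R" using pos[of "X \<alpha>"] X(1)[of \<alpha>] a(3) by (force simp: \<mu>_def)
  then have "V \<alpha> R = 0" using a(3) by (simp add: \<mu>_def)
  with a Z pos show thesis by (intro that[of \<alpha> "Z \<alpha>"]) (auto simp: V_def)
qed

text \<open>As \<open>\<alpha> \<rightarrow> 0\<close>, the solutions divided by \<open>\<alpha>\<close> converge to the solution of the linearised problem.\<close>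

lemma small_data_positive:
  assumes R: "R > 0" and F: "L-lipschitz_on UNIV F" and lim: "((\<lambda>t. F t / t) \<longlongrightarrow> c) (at_right 0)"
    and eig: "\<And>z r. \<lbrakk>sol (\<lambda>t. c * max t 0) 1 z; r \<in> {0..R}\<rbrakk> \<Longrightarrow> radial_v 1 z r > 0"
  shows "\<forall>\<^sub>F \<alpha> in at_right 0. \<forall>z. sol F \<alpha> z \<longrightarrow> (\<forall>r\<in>{0..R}. radial_v \<alpha> z r > 0)"
proof -
  have L: "L \<ge> 0" using F by (rule lipschitz_on_nonneg)
  have lin: "\<bar>c\<bar>-lipschitz_on UNIV (\<lambda>t. c * max t 0)"
  proof (rule lipschitz_onI)
    fix s t :: real
    have "\<bar>max s 0 - max t 0\<bar> \<le> \<bar>s - t\<bar>" by linarith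
    then have "\<bar>c\<bar> * \<bar>max s 0 - max t 0\<bar> \<le> \<bar>c\<bar> * \<bar>s - t\<bar>" by (rule mult_left_mono) simp
    then show "dist (c * max s 0) (c * max t 0) \<le> \<bar>c\<bar> * dist s t"
      by (simp add: dist_real_def abs_mult flip: right_diff_distrib)
  qed simp
  obtain w where w: "sol (\<lambda>t. c * max t 0) 1 w" using sol_exists[OF lin] by blast
  let ?w = "radial_v 1 w"
  have wc: "continuous_on {0..R} ?w" by (rule continuous_on_sol_radial_v[OF w])
  obtain x where x: "x \<in> {0..R}" "\<And>r. r \<in> {0..R} \<Longrightarrow> ?w x \<le> ?w r"
    using continuous_attains_inf[OF _ _ wc] R by auto
  obtain y where y: "y \<in> {0..R}" "\<And>r. r \<in> {0..R} \<Longrightarrow> ?w r \<le> ?w y"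
    using continuous_attains_sup[OF _ _ wc] R by auto
  have d: "?w x > 0" and B: "?w y > 0" using eig[OF w] x y by auto
  \<comment> \<open>With this tolerance the rescaled solution deviates from w by at most half the
    minimum of w.\<close>
  define \<epsilon> where "\<epsilon> = ?w x / (2 * stab L R)"
  have \<epsilon>: "\<epsilon> > 0" using d stab_pos[OF L, of R] by (simp add: \<epsilon>_def)
  \<comment> \<open>Division by the maximum of w turns the error of the quotient F(t) / t, once
    multiplied by w, into an absolute error of at most \<epsilon>.\<close>
  have "\<forall>\<^sub>F t in at_right 0. dist (F t / t) c < \<epsilon> / ?w y" using lim \<epsilon> B by (intro tendstoD) auto
  then obtain \<delta> where \<delta>: "\<delta> > 0" "\<And>t. \<lbrakk>0 < t; t < \<delta>\<rbrakk> \<Longrightarrow> dist (F t / t) c < \<epsilon> / ?w y"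
    unfolding eventually_at_right_field by auto
  have "radial_v \<alpha> z r > 0" if \<alpha>: "0 < \<alpha>" "\<alpha> < \<delta> / ?w y" and z: "sol F \<alpha> z" and r: "r \<in> {0..R}" for \<alpha> z r
  proof -
    \<comment> \<open>Scaling argument and value by the same factor preserves the Lipschitz
      constant, so the stability constant does not depend on \<alpha>.\<close>
    define G where "G = (\<lambda>t. F (t * \<alpha>) / \<alpha>)"
    have G: "L-lipschitz_on UNIV G"
    proof (rule lipschitz_onI)
      fix s t :: real
      have "dist (F (s * \<alpha>)) (F (t * \<alpha>)) \<le> L * dist (s * \<alpha>) (t * \<alpha>)" by (rule lipschitz_onD[OF F]) auto
      also have "\<dots> = L * dist s t * \<alpha>" using \<alpha> by (simp add: dist_real_def abs_mult flip: left_diff_distrib)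
      finally show "dist (G s) (G t) \<le> L * dist s t"
        using \<alpha> by (simp add: G_def dist_real_def field_simps flip: diff_divide_distrib)
    qed (rule L)
    have s: "sol G 1 (\<lambda>r. z r / \<alpha>)" and v: "radial_v 1 (\<lambda>r. z r / \<alpha>) r = radial_v \<alpha> z r / \<alpha>"
      using sol_scale[OF z, of "1 / \<alpha>" 1] \<alpha> by (simp_all add: G_def)
    have "\<bar>radial_v 1 (\<lambda>r. z r / \<alpha>) r - ?w r\<bar> \<le> \<bar>1 - 1\<bar> + stab L R * (\<epsilon> + L * \<bar>1 - 1\<bar>)"
    proof (rule radial_v_stability[OF s w G lipschitz_on_continuous_on[OF lin] _ r])
      fix q assume q: "q \<in> {0..R}"
      have wq: "0 < ?w q" "?w q \<le> ?w y" using eig[OF w q] y(2)[OF q] by auto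
      have "?w q * \<alpha> < \<delta>"
      proof -
        have "?w q * \<alpha> \<le> ?w y * \<alpha>" using wq \<alpha> by simp
        also have "\<dots> < \<delta>" using \<alpha> B by (simp add: field_simps)
        finally show ?thesis .
      qed
      then have "dist (F (?w q * \<alpha>) / (?w q * \<alpha>)) c < \<epsilon> / ?w y" using wq \<alpha> by (intro \<delta>) auto
      then have "\<bar>F (?w q * \<alpha>) / (?w q * \<alpha>) - c\<bar> * ?w q \<le> \<epsilon> / ?w y * ?w q"
        using wq by (intro mult_right_mono) (auto simp: dist_real_def)
      also have "\<dots> \<le> \<epsilon>" using wq B \<epsilon> by (simp add: field_simps)
      also have "\<bar>F (?w q * \<alpha>) / (?w q * \<alpha>) - c\<bar> * ?w q = \<bar>G (?w q) - c * max (?w q) 0\<bar>"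
        using wq \<alpha> by (simp add: G_def abs_mult_pos left_diff_distrib)
      finally show "\<bar>G (?w q) - c * max (?w q) 0\<bar> \<le> \<epsilon>" .
    qed
    also have "\<dots> = ?w x / 2" using stab_pos[OF L, of R] by (simp add: \<epsilon>_def)
    finally have "radial_v 1 (\<lambda>r. z r / \<alpha>) r > 0" using x(2)[OF r] d by linarith
    then show ?thesis using \<alpha> by (simp add: v zero_less_divide_iff)
  qed
  then show ?thesis unfolding eventually_at_right_field
    using \<delta>(1) B by (intro exI[of _ "\<delta> / ?w y"]) auto
qed

text \<open>Blow-up: \<open>v(\<beta> r) / \<alpha>\<close> with \<open>\<beta>\<^sup>2 = \<alpha>\<^bsup>1-p\<^esup>\<close> solves an equation whose nonlinearity
  \<open>\<alpha>\<^bsup>-p\<^esup> F(\<alpha> t)\<close> tends to \<open>C t\<^sup>p\<close>. Truncating at \<open>\<alpha> M\<close> becomes truncating at \<open>M\<close>.\<close>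

lemma large_data_sign_change:
  assumes R: "R > 0" and Fc: "continuous_on {0..} F"
    and lim: "((\<lambda>t. F t / t powr p) \<longlongrightarrow> C) at_top" and p: "p > 1" and M: "M > 0"
    and no_entire: "\<And>z. sol (\<lambda>t. C * clip M t powr p) 1 z \<Longrightarrow> \<exists>r\<ge>0. radial_v 1 z r < 0"
  shows "\<forall>\<^sub>F \<alpha> in at_top. \<forall>z. sol (\<lambda>t. F (clip (\<alpha> * M) t)) \<alpha> z \<longrightarrow> (\<exists>r\<in>{0..R}. radial_v \<alpha> z r < 0)"
proof -
  define L where "L = \<bar>C\<bar> * (p * M powr (p - 1))"
  have lip: "L-lipschitz_on UNIV (\<lambda>t. C * clip M t powr p)"
    using lipschitz_on_cmult_real[OF lipschitz_clip[OF lipschitz_powr[OF p], of M], of C] M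
    by (simp add: L_def)
  have L: "L \<ge> 0" using lip by (rule lipschitz_on_nonneg)
  obtain w where w: "sol (\<lambda>t. C * clip M t powr p) 1 w" using sol_exists[OF lip] by blast
  then obtain q where q: "q \<ge> 0" "radial_v 1 w q < 0" using no_entire by blast
  \<comment> \<open>Chosen so that half of the negative value of w at q survives the
    perturbation.\<close>
  define \<epsilon> where "\<epsilon> = - radial_v 1 w q / (2 * stab L q)"
  have \<epsilon>: "\<epsilon> > 0" using q stab_pos[OF L, of q] by (simp add: \<epsilon>_def divide_neg_pos)
  have "\<forall>\<^sub>F \<alpha> in at_top. \<forall>s\<in>{0..M}. \<bar>\<alpha> powr (- p) * F (\<alpha> * s) - C * s powr p\<bar> \<le> \<epsilon>"
    using p by (intro rescaled_power_limit[OF Fc lim _ M \<epsilon>]) auto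
  moreover have "((\<lambda>\<alpha>. \<alpha> powr ((1 - p) / 2) * q) \<longlongrightarrow> 0 * q) at_top"
    using p by (intro tendsto_intros tendsto_neg_powr filterlim_ident) auto
  then have "\<forall>\<^sub>F \<alpha> in at_top. \<alpha> powr ((1 - p) / 2) * q < R"
    using R by (intro order_tendstoD) auto
  ultimately show ?thesis using eventually_gt_at_top[of 0]
  proof eventually_elim
    case (elim \<alpha>)
    show ?case
    proof (intro allI impI)
      fix z assume z: "sol (\<lambda>t. F (clip (\<alpha> * M) t)) \<alpha> z"
      define \<beta> where "\<beta> = \<alpha> powr ((1 - p) / 2)"
      have \<beta>: "\<beta> > 0" using elim by (simp add: \<beta>_def)
      have \<beta>2: "1 / \<alpha> * \<beta>\<^sup>2 = \<alpha> powr (- p)"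
      proof -
        have "\<beta>\<^sup>2 = \<alpha> powr (1 - p)" using elim by (simp add: \<beta>_def power2_eq_square flip: powr_add)
        then show ?thesis using elim by (simp add: powr_diff powr_minus field_simps)
      qed
      define G where "G = (\<lambda>t. \<alpha> powr (- p) * F (\<alpha> * clip M t))"
      define y where "y = (\<lambda>r. 1 / \<alpha> * \<beta>\<^sup>2 * z (\<beta> * r))"
      have "sol (\<lambda>t. 1 / \<alpha> * \<beta>\<^sup>2 * F (clip (\<alpha> * M) (t / (1 / \<alpha>)))) (1 / \<alpha> * \<alpha>) y"
        unfolding y_def using elim by (intro sol_scale(1)[OF z]) auto
      moreover have "F (clip (\<alpha> * M) (t / (1 / \<alpha>))) = F (\<alpha> * clip M t)" for t
        using clip_scale[of \<alpha> M t] elim by (simp add: mult.commute)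
      ultimately have s: "sol G 1 y"
        unfolding \<beta>2 G_def using elim by simp
      have v: "radial_v 1 y q = radial_v \<alpha> z (\<beta> * q) / \<alpha>"
        using sol_scale(2)[OF z, of "1 / \<alpha>" \<beta> q] elim by (simp add: y_def)
      have cl: "continuous_on UNIV (clip M)" unfolding clip_def by (intro continuous_intros)
      have Gc: "continuous_on UNIV G"
        unfolding G_def using elim M clip_range[of M]
        by (intro continuous_intros continuous_on_compose2[OF Fc] cl) (auto intro!: mult_nonneg_nonneg)
      \<comment> \<open>The limit nonlinearity takes the Lipschitz role because its constant is
        independent of \<alpha>. The rescaled one is merely continuous and is compared along its own
        solution \<open>y\<close>; clipping keeps the arguments in [0, M], where the convergence is
        uniform.\<close>
      have "\<bar>radial_v 1 w q - radial_v 1 y q\<bar> \<le> \<bar>1 - 1\<bar> + stab L q * (\<epsilon> + L * \<bar>1 - 1\<bar>)"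
      proof (rule radial_v_stability[OF w s lip Gc])
        fix r
        show "\<bar>C * clip M (radial_v 1 y r) powr p - G (radial_v 1 y r)\<bar> \<le> \<epsilon>"
          using elim(1) clip_range[of M "radial_v 1 y r"] M by (auto simp: G_def abs_minus_commute)
      qed (use q in auto)
      also have "\<dots> = - radial_v 1 w q / 2" using stab_pos[OF L, of q] by (simp add: \<epsilon>_def)
      finally have "radial_v 1 y q < 0" using q by linarith
      then have "radial_v \<alpha> z (\<beta> * q) < 0" using elim by (simp add: v divide_less_0_iff)
      \<comment> \<open>Since p > 1, \<beta> tends to 0 as \<alpha> grows, so the fixed blow-up
        radius q is pulled back inside [0, R].\<close>
      moreover have "\<beta> * q \<in> {0..R}" using \<beta> q elim by (simp add: \<beta>_def)
      ultimately show "\<exists>r\<in>{0..R}. radial_v \<alpha> z r < 0" by blast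
    qed
  qed
qed

text \<open>The order of choices avoids circularity. The growth bound fixes M, the blow-up with
  truncation at \<alpha> M fixes \<alpha>1, and then K = \<alpha>1 M is kept for the whole shooting
  interval. For \<alpha> \<le> \<alpha>1 the growth bound gives v \<le> M \<alpha> \<le> K, so the
  truncation is inactive on the solution found.\<close>

lemma radial_positive_solution:
  assumes R: "R > 0" and lip: "\<And>K. K > 0 \<Longrightarrow> \<exists>L. L-lipschitz_on {0..K} F" and F0: "F 0 = 0"
    and \<gamma>: "\<gamma> \<ge> 0" "\<And>t. t \<ge> 0 \<Longrightarrow> F t \<ge> - \<gamma> * t"
    and lim0: "((\<lambda>t. F t / t) \<longlongrightarrow> c) (at_right 0)"
    and lim: "((\<lambda>t. F t / t powr p) \<longlongrightarrow> C) at_top" and p: "p > 1"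
    and eig: "\<And>z r. \<lbrakk>sol (\<lambda>t. c * max t 0) 1 z; r \<in> {0..R}\<rbrakk> \<Longrightarrow> radial_v 1 z r > 0"
    and no_entire: "\<And>M z. \<lbrakk>M \<ge> 1; sol (\<lambda>t. C * clip M t powr p) 1 z\<rbrakk> \<Longrightarrow> \<exists>r\<ge>0. radial_v 1 z r < 0"
  obtains K \<alpha> z where "K > 0" "\<alpha> > 0" "continuous_on UNIV (\<lambda>t. F (clip K t))" "sol (\<lambda>t. F (clip K t)) \<alpha> z"
    "\<And>r. \<lbrakk>0 \<le> r; r < R\<rbrakk> \<Longrightarrow> radial_v \<alpha> z r > 0" "radial_v \<alpha> z R = 0"
    "\<And>r. r \<in> {0..R} \<Longrightarrow> radial_v \<alpha> z r \<le> K"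
proof -
  have "isCont F t" if t: "t > 0" for t
  proof -
    obtain L where "L-lipschitz_on {0..t + 1} F" using lip[of "t + 1"] t by force
    then have "continuous_on {0..t + 1} F" by (rule lipschitz_on_continuous_on)
    then show ?thesis using t by (intro continuous_on_interior[of "{0..t + 1}"]) (auto simp: interior_atLeastAtMost_real)
  qed
  moreover have "continuous (at 0 within {0..}) F"
  proof -
    obtain L where "L-lipschitz_on {0..1} F" using lip[of 1] by force
    then have "continuous_on {0..1} F" by (rule lipschitz_on_continuous_on)
    then have "continuous (at 0 within {0..1}) F" by (simp add: continuous_on_eq_continuous_within)
    moreover have "at 0 within {0..1} = at (0::real) within {0..}"
      by (rule at_within_nhd[of _ "{..<1}"]) auto
    ultimately show ?thesis by simp
  qed
  ultimately have Fc: "continuous_on {0..} F"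
    unfolding continuous_on_eq_continuous_within
    by (metis atLeast_iff continuous_at_imp_continuous_at_within order_le_less)
  define M where "M = 2 * exp (growth \<gamma> * R)"
  have "growth \<gamma> \<ge> 0" using \<gamma> ell_pos by (simp add: growth_def)
  then have "1 \<le> exp (growth \<gamma> * R)" using R by simp
  then have M: "M \<ge> 1" unfolding M_def by linarith
  have "\<forall>\<^sub>F \<alpha> in at_top. \<forall>z. sol (\<lambda>t. F (clip (\<alpha> * M) t)) \<alpha> z \<longrightarrow> (\<exists>r\<in>{0..R}. radial_v \<alpha> z r < 0)"
    using no_entire[OF M] M by (intro large_data_sign_change[OF R Fc lim p]) auto
  then have "\<forall>\<^sub>F \<alpha> in at_top. \<alpha> > 0 \<and> (\<forall>z. sol (\<lambda>t. F (clip (\<alpha> * M) t)) \<alpha> z \<longrightarrow> (\<exists>r\<in>{0..R}. radial_v \<alpha> z r < 0))"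
    using eventually_gt_at_top[of 0] by eventually_elim auto
  then obtain \<alpha>1 where \<alpha>1: "\<alpha>1 > 0"
    "\<And>z. sol (\<lambda>t. F (clip (\<alpha>1 * M) t)) \<alpha>1 z \<Longrightarrow> \<exists>r\<in>{0..R}. radial_v \<alpha>1 z r < 0"
    using eventually_happens'[OF trivial_limit_at_top_linorder] by blast
  define K where "K = \<alpha>1 * M"
  define FK where "FK = (\<lambda>t. F (clip K t))"
  have K: "K > 0" using \<alpha>1 M by (simp add: K_def)
  obtain L where "L-lipschitz_on {0..K} F" using lip[OF K] by blast
  then have FK: "L-lipschitz_on UNIV FK" unfolding FK_def using K by (intro lipschitz_clip) auto
  have FKc: "continuous_on UNIV FK" using FK by (rule lipschitz_on_continuous_on)
  obtain z1 where z1: "sol FK \<alpha>1 z1" using sol_exists[OF FK] by blast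
  then obtain r1 where r1: "r1 \<in> {0..R}" "radial_v \<alpha>1 z1 r1 < 0" using \<alpha>1(2) unfolding FK_def K_def by blast
  have "((\<lambda>t. FK t / t) \<longlongrightarrow> c) (at_right 0)"
  proof (rule Lim_transform_eventually[OF lim0])
    show "\<forall>\<^sub>F t in at_right 0. F t / t = FK t / t"
      unfolding eventually_at_right_field using K by (intro exI[of _ K]) (auto simp: FK_def clip_id)
  qed
  then have "\<forall>\<^sub>F \<alpha> in at_right 0. \<forall>z. sol FK \<alpha> z \<longrightarrow> (\<forall>r\<in>{0..R}. radial_v \<alpha> z r > 0)"
    using eig by (intro small_data_positive[OF R FK]) auto
  moreover have "\<forall>\<^sub>F \<alpha> in at_right 0. 0 < \<alpha> \<and> \<alpha> \<le> \<alpha>1"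
    unfolding eventually_at_right_field using \<alpha>1 by (intro exI[of _ \<alpha>1]) auto
  ultimately have "\<forall>\<^sub>F \<alpha> in at_right 0. 0 < \<alpha> \<and> \<alpha> \<le> \<alpha>1 \<and> (\<forall>z. sol FK \<alpha> z \<longrightarrow> (\<forall>r\<in>{0..R}. radial_v \<alpha> z r > 0))"
    by eventually_elim auto
  then obtain \<alpha>0 where \<alpha>0: "0 < \<alpha>0" "\<alpha>0 \<le> \<alpha>1"
    "\<And>z r. \<lbrakk>sol FK \<alpha>0 z; r \<in> {0..R}\<rbrakk> \<Longrightarrow> radial_v \<alpha>0 z r > 0"
    using eventually_happens'[OF trivial_limit_at_right_real] by blast
  have FK0: "FK 0 = 0" using F0 K by (simp add: FK_def clip_id)
  obtain \<alpha> z where az: "\<alpha>0 \<le> \<alpha>" "\<alpha> \<le> \<alpha>1" "sol FK \<alpha> z"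
    "\<And>r. \<lbrakk>0 \<le> r; r < R\<rbrakk> \<Longrightarrow> radial_v \<alpha> z r > 0" "radial_v \<alpha> z R = 0"
    using shooting[OF FK FK0 R \<alpha>0(1,2) \<alpha>0(3) z1 r1(1)] r1(2) by (metis less_imp_le)
  have "radial_v \<alpha> z r \<le> K" if "r \<in> {0..R}" for r
  proof -
    have "radial_v \<alpha> z r \<le> 2 * exp (growth \<gamma> * R) * \<alpha>"
    proof (rule radial_v_growth[OF az(3) FKc _ \<gamma>(1) _ that])
      fix t
      have "- \<gamma> * max t 0 \<le> - \<gamma> * clip K t"
        using \<gamma>(1) K by (intro mult_left_mono_neg) (auto simp: clip_def)
      also have "\<dots> \<le> FK t" unfolding FK_def using clip_range[of K t] K by (intro \<gamma>(2)) auto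
      finally show "FK t \<ge> - \<gamma> * max t 0" .
    qed (use az \<alpha>0 in auto)
    also have "\<dots> \<le> K" unfolding K_def M_def using az(2) by (simp add: mult.commute)
    finally show ?thesis .
  qed
  with az K \<alpha>0 FKc show thesis unfolding FK_def by (intro that[of K \<alpha> z]) auto
qed

end

section \<open>Radial functions and their Hessians\<close>

text \<open>Eigenvalue w along x and z on the orthogonal complement of x. At x = 0 the quotient is 0
  by convention and \<open>tensor_square\<close> vanishes, leaving z times the identity.\<close>

definition radial_matrix :: "real \<Rightarrow> real \<Rightarrow> real ^ 'n \<Rightarrow> real ^ 'n ^ 'n" where
  "radial_matrix z w x = z *\<^sub>R mat 1 + ((w - z) / (norm x)\<^sup>2) *\<^sub>R tensor_square x"

lemma tensor_square_mult_vec: "tensor_square x *v v = (x \<bullet> v) *\<^sub>R x"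
  by (simp add: tensor_square_def matrix_vector_mult_def vec_eq_iff inner_vec_def sum_distrib_left
      sum_distrib_right mult_ac)

lemma tensor_square_scaleR: "tensor_square (c *\<^sub>R x) = c\<^sup>2 *\<^sub>R tensor_square x"
  by (simp add: tensor_square_def vec_eq_iff power2_eq_square)

lemma radial_matrix_mult_vec:
  "radial_matrix z w x *v v = z *\<^sub>R v + ((w - z) / (norm x)\<^sup>2 * (x \<bullet> v)) *\<^sub>R x"
  unfolding radial_matrix_def
  by (simp add: matrix_vector_mult_add_rdistrib scaleR_matrix_vector_assoc[symmetric] tensor_square_mult_vec)

text \<open>The eigenspaces are the line of e and the hyperplane orthogonal to it; for w = z they
  merge, and the formula still counts n copies. An arbitrary \<open>P\<close> covers the positive
  and the negative sum at once, and n \<ge> 2 makes the hyperplane nontrivial.\<close>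

lemma rank_one_eigen_sum:
  fixes M :: "real ^ 'n ^ 'n" and e :: "real ^ 'n"
  assumes M: "\<And>v. M *v v = z *\<^sub>R v + ((w - z) * (e \<bullet> v)) *\<^sub>R e" and e: "norm e = 1"
    and n: "CARD('n) \<ge> 2"
  shows "(\<Sum>t\<in>{t \<in> eigenvalues M. P t}. real (dim (eigenspace M t)) * t)
    = (if P w then w else 0) + (real CARD('n) - 1) * (if P z then z else 0)"
proof (cases "w = z")
  case True
  have E: "eigenspace M t = (if t = z then UNIV else {0})" for t
    by (auto simp: eigenspace_def M True)
  have ev: "eigenvalues M = {z}"
    using e unfolding eigenvalues_def E by (auto intro!: exI[of _ e])
  have "{t \<in> eigenvalues M. P t} = (if P z then {z} else {})" unfolding ev by auto
  then show ?thesis by (simp add: E True algebra_simps)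
next
  case False
  have ee: "e \<bullet> e = 1" using e by (simp add: dot_square_norm)
  have Ew: "eigenspace M w = span {e}"
  proof
    show "eigenspace M w \<subseteq> span {e}"
    proof
      fix v assume "v \<in> eigenspace M w"
      then have "(w - z) *\<^sub>R (v - (e \<bullet> v) *\<^sub>R e) = 0"
        by (simp add: eigenspace_def M algebra_simps)
      then have "v = (e \<bullet> v) *\<^sub>R e" using False by simp
      then show "v \<in> span {e}" by (metis span_base span_mul singletonI)
    qed
    show "span {e} \<subseteq> eigenspace M w"
      by (auto simp: span_singleton eigenspace_def M ee algebra_simps)
  qed
  have Ez: "eigenspace M z = {v. e \<bullet> v = 0}"
    using False e by (auto simp: eigenspace_def M)
  have dw: "dim (eigenspace M w) = 1" unfolding Ew using e by (auto simp: dim_singleton)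
  have dz: "dim (eigenspace M z) = CARD('n) - 1" unfolding Ez using e by (subst dim_hyperplane) auto
  have other: "t = w \<or> t = z" if "v \<noteq> 0" "v \<in> eigenspace M t" for t v
  proof -
    have v: "z *\<^sub>R v + ((w - z) * (e \<bullet> v)) *\<^sub>R e = t *\<^sub>R v" using that by (simp add: eigenspace_def M)
    then have "e \<bullet> (z *\<^sub>R v + ((w - z) * (e \<bullet> v)) *\<^sub>R e) = e \<bullet> (t *\<^sub>R v)" by simp
    then have "(w - t) * (e \<bullet> v) = 0" by (simp add: inner_add_right ee algebra_simps)
    moreover have "t = z" if "e \<bullet> v = 0" using v that \<open>v \<noteq> 0\<close> by simp
    ultimately show ?thesis by auto
  qed
  have "\<exists>v. v \<noteq> 0 \<and> v \<in> eigenspace M z"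
  proof (rule ccontr)
    assume "\<nexists>v. v \<noteq> 0 \<and> v \<in> eigenspace M z"
    then have "eigenspace M z \<subseteq> {0}" by auto
    then have "dim (eigenspace M z) = 0" by simp
    then show False using dz n by simp
  qed
  moreover have "e \<noteq> 0 \<and> e \<in> eigenspace M w" using e unfolding Ew by (auto intro: span_base)
  ultimately have ev: "eigenvalues M = {w, z}" using other unfolding eigenvalues_def by blast
  have "{t \<in> {w, z}. P t} = (if P w then {w} else {}) \<union> (if P z then {z} else {})" by auto
  then show ?thesis unfolding ev using False n by (auto simp: dw dz of_nat_diff)
qed

text \<open>Selecting the two slopes by the sign lets a single ODE theory serve both
  operators.\<close>

definition upper_slope :: "pucci_sign \<Rightarrow> real \<Rightarrow> real \<Rightarrow> real" where
  "upper_slope s lam Lam = (case s of Plus_Op \<Rightarrow> Lam | Minus_Op \<Rightarrow> lam)"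

definition lower_slope :: "pucci_sign \<Rightarrow> real \<Rightarrow> real \<Rightarrow> real" where
  "lower_slope s lam Lam = (case s of Plus_Op \<Rightarrow> lam | Minus_Op \<Rightarrow> Lam)"

lemma pucci_radial_matrix:
  fixes x :: "real ^ 'n"
  assumes "CARD('n) \<ge> 2" and zero: "x = 0 \<Longrightarrow> w = z"
  shows "pucci s lam Lam (radial_matrix z w x) =
    two_slope (upper_slope s lam Lam) (lower_slope s lam Lam) w
    + (real CARD('n) - 1) * two_slope (upper_slope s lam Lam) (lower_slope s lam Lam) z"
proof -
  obtain e :: "real ^ 'n" where e: "norm e = 1"
    and M: "\<And>v. radial_matrix z w x *v v = z *\<^sub>R v + ((w - z) * (e \<bullet> v)) *\<^sub>R e"
  proof (cases "x = 0")
    case True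
    \<comment> \<open>The origin distinguishes no direction; with w = z the rank-one term vanishes
      and any unit vector will do.\<close>
    then show thesis by (intro that[of "axis undefined 1"]) (auto simp: radial_matrix_mult_vec zero)
  next
    case False
    then show thesis
      by (intro that[of "x /\<^sub>R norm x"]) (auto simp: radial_matrix_mult_vec power2_eq_square field_simps)
  qed
  have pos: "pos_eigen_sum (radial_matrix z w x) = max w 0 + (real CARD('n) - 1) * max z 0"
    unfolding pos_eigen_sum_def rank_one_eigen_sum[OF M e assms(1)] by (simp add: max_def)
  have neg: "neg_eigen_sum (radial_matrix z w x) = min w 0 + (real CARD('n) - 1) * min z 0"
    unfolding neg_eigen_sum_def rank_one_eigen_sum[OF M e assms(1)] by (simp add: min_def)
  show ?thesis
    by (cases s) (simp_all add: pos neg upper_slope_def lower_slope_def two_slope_def, simp_all add: algebra_simps)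
qed

lemma tendsto_norm_at_0:
  assumes "(f \<longlongrightarrow> l) (at (0::real) within {0..})"
  shows "((\<lambda>x :: real ^ 'n. f (norm x)) \<longlongrightarrow> l) (at 0)"
proof (rule filterlim_compose[OF assms])
  have "filterlim norm (at_right 0) (at (0 :: real ^ 'n))"
    by (auto simp: filterlim_at eventually_at_filter tendsto_norm_zero tendsto_ident_at)
  moreover have "at_right (0::real) \<le> at 0 within {0..}" by (rule at_le) auto
  ultimately show "filterlim norm (at 0 within {0..}) (at (0 :: real ^ 'n))"
    by (rule filterlim_mono) auto
qed

text \<open>Z stands for U'/r and W for U''. Stated apart from the differential equation so that it
  applies both to v and to u = \<open>phi_inv g\<close> of v; \<open>W_0\<close> is the condition
  for C^2 regularity at the origin.\<close>

locale radial_profile =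
  fixes U Z W :: "real \<Rightarrow> real" and \<rho> :: real
  assumes deriv_U: "\<And>r. \<lbrakk>0 < r; r < \<rho>\<rbrakk> \<Longrightarrow> (U has_real_derivative r * Z r) (at r)"
    and deriv_U_0: "(U has_real_derivative 0) (at 0 within {0..})"
    and deriv_Z: "\<And>r. \<lbrakk>0 < r; r < \<rho>\<rbrakk> \<Longrightarrow> ((\<lambda>r. r * Z r) has_real_derivative W r) (at r)"
    and cont_Z: "continuous_on {0..<\<rho>} Z" and cont_W: "continuous_on {0..<\<rho>} W"
    and W_0: "W 0 = Z 0"
begin

lemma tendsto_at_0_within:
  assumes "continuous_on {0..<\<rho>} f" "\<rho> > 0"
  shows "(f \<longlongrightarrow> f 0) (at 0 within {0..})"
proof -
  have "(f \<longlongrightarrow> f 0) (at 0 within {0..<\<rho>})" using assms unfolding continuous_on_def by auto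
  moreover have "at 0 within {0..<\<rho>} = at (0::real) within {0..}"
    using assms by (intro at_within_nhd[of _ "{..<\<rho>}"]) auto
  ultimately show ?thesis by simp
qed

lemma has_derivative_radial:
  fixes x :: "real ^ 'n"
  assumes x: "norm x < \<rho>"
  shows "((\<lambda>x. U (norm x)) has_derivative (\<lambda>h. Z (norm x) * (x \<bullet> h))) (at x)"
proof (cases "x = 0")
  case True
  have "((\<lambda>r. \<bar>(U r - U 0) / (r - 0)\<bar>) \<longlongrightarrow> \<bar>0\<bar>) (at 0 within {0..})"
    using deriv_U_0 unfolding has_field_derivative_iff by (rule tendsto_rabs)
  from tendsto_norm_at_0[OF this] show ?thesis
    unfolding True has_derivative_iff_norm by (simp add: abs_divide)
next
  case False
  have "(U has_derivative (*) (norm x * Z (norm x))) (at (norm x))"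
    using deriv_U[of "norm x"] x False by (simp add: has_field_derivative_def)
  from has_derivative_compose[OF has_derivative_norm[OF False] this]
  have "((\<lambda>x. U (norm x)) has_derivative (\<lambda>h. norm x * Z (norm x) * (h \<bullet> sgn x))) (at x)" .
  moreover have "(\<lambda>h. norm x * Z (norm x) * (h \<bullet> sgn x)) = (\<lambda>h. Z (norm x) * (x \<bullet> h))"
    using False by (simp add: fun_eq_iff sgn_div_norm inner_commute)
  ultimately show ?thesis by simp
qed

lemma gradient_radial:
  fixes x :: "real ^ 'n"
  assumes x: "norm x < \<rho>"
  shows "gradient (\<lambda>x. U (norm x)) x = Z (norm x) *\<^sub>R x"
  unfolding gradient_def frechet_derivative_at[OF has_derivative_radial[OF x], symmetric]
  by (simp add: vec_eq_iff inner_axis)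

text \<open>Away from 0, Z' = (W - Z) / r by the quotient rule for (r Z) / r, and the chain rule
  produces the rank-one part. At 0 the remainder quotient is exactly |Z(|y|) - Z(0)|, so continuity
  of Z suffices.\<close>

lemma has_derivative_radial_field:
  fixes x :: "real ^ 'n"
  assumes x: "norm x < \<rho>"
  shows "((\<lambda>x. Z (norm x) *\<^sub>R x) has_derivative (\<lambda>h. radial_matrix (Z (norm x)) (W (norm x)) x *v h)) (at x)"
proof (cases "x = 0")
  case True
  have "(Z \<longlongrightarrow> Z 0) (at 0 within {0..})" using x True by (intro tendsto_at_0_within cont_Z) simp
  then have "((\<lambda>r. \<bar>Z r - Z 0\<bar>) \<longlongrightarrow> \<bar>Z 0 - Z 0\<bar>) (at 0 within {0..})" by (intro tendsto_intros)
  from tendsto_norm_at_0[OF this]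
  have lim: "((\<lambda>y :: real ^ 'n. \<bar>Z (norm y) - Z 0\<bar>) \<longlongrightarrow> 0) (at 0)" by simp
  have "((\<lambda>y :: real ^ 'n. norm (Z (norm y) *\<^sub>R y - Z 0 *\<^sub>R y) / norm y) \<longlongrightarrow> 0) (at 0)"
    by (rule Lim_transform_eventually[OF lim])
      (auto simp: eventually_at_filter simp flip: scaleR_left_diff_distrib)
  then show ?thesis
    unfolding True has_derivative_iff_norm by (simp add: radial_matrix_mult_vec bounded_linear_scaleR_right)
next
  case False
  let ?r = "norm x"
  have r: "0 < ?r" using False by simp
  have "((\<lambda>r. (r * Z r) / r) has_real_derivative (W ?r * ?r - (?r * Z ?r) * 1) / (?r * ?r)) (at ?r)"
    by (rule DERIV_divide[OF deriv_Z[OF r x]]) (use r in auto)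
  then have "(Z has_real_derivative (W ?r * ?r - (?r * Z ?r) * 1) / (?r * ?r)) (at ?r)"
    by (rule has_field_derivative_transform_within_open[where S = "{0<..}"]) (use r in auto)
  moreover have "(W ?r * ?r - (?r * Z ?r) * 1) / (?r * ?r) = (W ?r - Z ?r) / ?r"
    using r by (simp add: field_simps)
  ultimately have "(Z has_derivative (*) ((W ?r - Z ?r) / ?r)) (at ?r)"
    by (simp add: has_field_derivative_def)
  from has_derivative_scaleR[OF has_derivative_compose[OF has_derivative_norm[OF False] this] has_derivative_ident]
  have "((\<lambda>x. Z (norm x) *\<^sub>R x) has_derivative
      (\<lambda>h. Z ?r *\<^sub>R h + ((W ?r - Z ?r) / ?r * (h \<bullet> sgn x)) *\<^sub>R x)) (at x)" by (simp add: inner_commute)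
  moreover have "(\<lambda>h. Z ?r *\<^sub>R h + ((W ?r - Z ?r) / ?r * (h \<bullet> sgn x)) *\<^sub>R x)
      = (\<lambda>h. radial_matrix (Z ?r) (W ?r) x *v h)"
    by (simp add: radial_matrix_mult_vec sgn_div_norm inner_commute power2_eq_square field_simps)
  ultimately show ?thesis by simp
qed

lemma has_derivative_gradient_radial:
  fixes x :: "real ^ 'n"
  assumes x: "norm x < \<rho>"
  shows "(gradient (\<lambda>x :: real ^ 'n. U (norm x)) has_derivative (\<lambda>h. radial_matrix (Z (norm x)) (W (norm x)) x *v h)) (at x)"
  by (rule has_derivative_transform_within_open[OF has_derivative_radial_field[OF x], of "ball 0 \<rho>"])
    (use x in \<open>auto simp: gradient_radial\<close>)

lemma hessian_radial:
  fixes x :: "real ^ 'n"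
  assumes x: "norm x < \<rho>"
  shows "hessian (\<lambda>x. U (norm x)) x = radial_matrix (Z (norm x)) (W (norm x)) x"
  unfolding hessian_def jacobian_def
    frechet_derivative_at[OF has_derivative_gradient_radial[OF x], symmetric] by simp

text \<open>Only the origin is delicate: there \<open>(x $ i) * (x $ j)\<close> is bounded by the
  square of the norm, which cancels the denominator, and W - Z tends to 0.\<close>

lemma continuous_on_radial_matrix:
  "continuous_on (ball 0 \<rho>) (\<lambda>x :: real ^ 'n. radial_matrix (Z (norm x)) (W (norm x)) x)"
proof -
  have norm: "continuous_on (ball 0 \<rho>) (\<lambda>x :: real ^ 'n. f (norm x))" if "continuous_on {0..<\<rho>} f" for f :: "real \<Rightarrow> real"
    by (rule continuous_on_compose2[OF that continuous_on_norm_id]) auto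
  have comp: "continuous_on (ball 0 \<rho>) (\<lambda>x :: real ^ 'n. (W (norm x) - Z (norm x)) / (norm x)\<^sup>2 * (x $ i * x $ j))" for i j
  proof (subst continuous_on_eq_continuous_at, simp, intro ballI)
    fix x :: "real ^ 'n" assume x: "x \<in> ball 0 \<rho>"
    have q: "continuous_on (ball 0 \<rho>) (\<lambda>x :: real ^ 'n. W (norm x) - Z (norm x))"
      by (intro continuous_intros norm cont_Z cont_W)
    then have qx: "isCont (\<lambda>x :: real ^ 'n. W (norm x) - Z (norm x)) y" if "y \<in> ball 0 \<rho>" for y
      using that by (simp add: continuous_on_eq_continuous_at)
    show "isCont (\<lambda>x :: real ^ 'n. (W (norm x) - Z (norm x)) / (norm x)\<^sup>2 * (x $ i * x $ j)) x"
    proof (cases "x = 0")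
      case False
      have "isCont (\<lambda>x :: real ^ 'n. (norm x)\<^sup>2) x" "isCont (\<lambda>x :: real ^ 'n. x $ i * x $ j) x"
        by (intro continuous_intros)+
      with False show ?thesis by (intro isCont_mult isCont_divide qx[OF x]) simp_all
    next
      case True
      have "((\<lambda>x :: real ^ 'n. W (norm x) - Z (norm x)) \<longlongrightarrow> 0) (at 0)"
        using qx[of 0] x True W_0 by (simp add: isCont_def)
      then have "((\<lambda>x :: real ^ 'n. (W (norm x) - Z (norm x)) / (norm x)\<^sup>2 * (x $ i * x $ j)) \<longlongrightarrow> 0) (at 0)"
      proof (rule Lim_null_comparison[rotated, OF tendsto_rabs_zero], intro always_eventually allI)
        fix y :: "real ^ 'n"
        have "\<bar>y $ i * y $ j\<bar> \<le> (norm y)\<^sup>2"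
          unfolding abs_mult power2_eq_square by (intro mult_mono component_le_norm_cart) auto
        then have "\<bar>W (norm y) - Z (norm y)\<bar> * \<bar>y $ i * y $ j\<bar> \<le> \<bar>W (norm y) - Z (norm y)\<bar> * (norm y)\<^sup>2"
          by (intro mult_left_mono) auto
        then show "norm ((W (norm y) - Z (norm y)) / (norm y)\<^sup>2 * (y $ i * y $ j)) \<le> \<bar>W (norm y) - Z (norm y)\<bar>"
          by (cases "y = 0") (simp_all add: abs_mult divide_simps)
      qed
      then show ?thesis by (simp add: True isCont_def)
    qed
  qed
  have eq: "radial_matrix (Z (norm x)) (W (norm x)) x = (\<chi> i j. Z (norm x) * (if i = j then 1 else 0)
      + (W (norm x) - Z (norm x)) / (norm x)\<^sup>2 * (x $ i * x $ j))" for x :: "real ^ 'n"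
    by (simp add: radial_matrix_def tensor_square_def mat_def vec_eq_iff)
  show ?thesis unfolding eq by (intro continuous_intros norm cont_Z comp)
qed

lemma C2_on_radial: "C2_on (ball 0 \<rho>) (\<lambda>x :: real ^ 'n. U (norm x))"
  unfolding C2_on_def
proof (intro conjI)
  show "(\<lambda>x :: real ^ 'n. U (norm x)) differentiable_on ball 0 \<rho>"
    unfolding differentiable_on_def differentiable_def
    by (intro ballI exI, rule has_derivative_at_withinI, rule has_derivative_radial) simp
  show "gradient (\<lambda>x :: real ^ 'n. U (norm x)) differentiable_on ball 0 \<rho>"
    unfolding differentiable_on_def differentiable_def
    by (intro ballI exI, rule has_derivative_at_withinI, rule has_derivative_gradient_radial) simp
  show "continuous_on (ball 0 \<rho>) (hessian (\<lambda>x :: real ^ 'n. U (norm x)))"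
    by (rule continuous_on_eq[OF continuous_on_radial_matrix]) (simp add: hessian_radial)
qed

end

lemma C2_on_UNIV:
  assumes "\<And>\<rho>. \<rho> > 0 \<Longrightarrow> C2_on (ball 0 \<rho>) u"
  shows "C2_on UNIV u"
proof -
  have "u differentiable (at x) \<and> gradient u differentiable (at x) \<and> isCont (hessian u) x" for x
  proof -
    have x: "x \<in> ball 0 (norm x + 1)" by simp
    have C: "C2_on (ball 0 (norm x + 1)) u" by (rule assms) (simp add: add_nonneg_pos)
    show ?thesis
      using C x unfolding C2_on_def differentiable_on_def
      by (auto simp: at_within_open[OF _ open_ball] continuous_on_eq_continuous_at)
  qed
  then show ?thesis
    by (simp add: C2_on_def differentiable_on_def continuous_on_eq_continuous_at)
qed

section \<open>The spectral and the critical hypotheses\<close>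

context radial_pucci begin

definition radial_w :: "(real \<Rightarrow> real) \<Rightarrow> real \<Rightarrow> (real \<Rightarrow> real) \<Rightarrow> real \<Rightarrow> real" where
  "radial_w F \<alpha> z r = H (z r) (F (radial_v \<alpha> z r))"

lemma continuous_on_radial_w:
  assumes "sol F \<alpha> z" "continuous_on UNIV F"
  shows "continuous_on S (radial_w F \<alpha> z)"
  unfolding radial_w_def
  by (intro continuous_on_H continuous_on_sol[OF assms(1)]
      continuous_on_compose2[OF assms(2) continuous_on_sol_radial_v[OF assms(1)]]) auto

lemma radial_w_0: "sol F \<alpha> z \<Longrightarrow> radial_w F \<alpha> z 0 = z 0"
  using sol_at_0 by (simp add: radial_w_def)

lemma m_radial_w: "m (radial_w F \<alpha> z r) + \<nu> * m (z r) = - F (radial_v \<alpha> z r)"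
  by (simp add: radial_w_def m_H)

lemma radial_profile_sol:
  assumes "sol F \<alpha> z" "continuous_on UNIV F"
  shows "radial_profile (radial_v \<alpha> z) z (radial_w F \<alpha> z) \<rho>"
proof
  show "(radial_v \<alpha> z has_real_derivative 0) (at 0 within {0..})"
    using sol_radial_v_deriv[OF assms(1), of 0] by simp
  show "((\<lambda>r. r * z r) has_real_derivative radial_w F \<alpha> z r) (at r)" if "0 < r" for r
    using sol_ode[OF assms that] by (simp add: radial_w_def)
qed (use assms in \<open>auto intro: sol_radial_v_deriv continuous_on_sol continuous_on_radial_w radial_w_0\<close>)

lemma radial_solution_pde:
  fixes x :: "real ^ 'n"
  assumes z: "sol F \<alpha> z" and F: "continuous_on UNIV F"
    and n: "CARD('n) \<ge> 2" "\<nu> = real CARD('n) - 1"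
    and op: "a = upper_slope s lam Lam" "b = lower_slope s lam Lam"
  shows "C2_on UNIV (\<lambda>x :: real ^ 'n. radial_v \<alpha> z (norm x))"
    and "pucci s lam Lam (hessian (\<lambda>x :: real ^ 'n. radial_v \<alpha> z (norm x)) x) = - F (radial_v \<alpha> z (norm x))"
proof -
  interpret radial_profile "radial_v \<alpha> z" z "radial_w F \<alpha> z" \<rho> for \<rho>
    by (rule radial_profile_sol[OF z F])
  show "C2_on UNIV (\<lambda>x :: real ^ 'n. radial_v \<alpha> z (norm x))"
    by (rule C2_on_UNIV) (rule C2_on_radial)
  have "hessian (\<lambda>x :: real ^ 'n. radial_v \<alpha> z (norm x)) x
      = radial_matrix (z (norm x)) (radial_w F \<alpha> z (norm x)) x"
    by (rule hessian_radial[of _ "norm x + 1"]) simp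
  then show "pucci s lam Lam (hessian (\<lambda>x :: real ^ 'n. radial_v \<alpha> z (norm x)) x) = - F (radial_v \<alpha> z (norm x))"
    using m_radial_w[of F \<alpha> z "norm x"] radial_w_0[OF z]
    by (simp add: pucci_radial_matrix n(1) flip: op n(2))
qed

text \<open>If the solution had a first zero \<open>q \<le> R\<close>, dilating it to \<open>B\<^sub>R\<close> would give a positive eigenfunction
  with eigenvalue \<open>(q / R)\<^sup>2 c < \<mu>\<close>, against the uniqueness of the eigenvalue.\<close>

lemma linear_solution_positive:
  assumes ev: "is_first_eigenvalue TYPE('n::finite) s lam Lam R \<mu>" and c: "c < \<mu>" and R: "R > 0"
    and n: "CARD('n) \<ge> 2" "\<nu> = real CARD('n) - 1"
    and op: "a = upper_slope s lam Lam" "b = lower_slope s lam Lam"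
    and z: "sol (\<lambda>t. c * max t 0) 1 z" and r: "r \<in> {0..R}"
  shows "radial_v 1 z r > 0"
proof (rule ccontr)
  assume neg: "\<not> radial_v 1 z r > 0"
  let ?v = "radial_v 1 z"
  have vc: "continuous_on S ?v" for S by (rule continuous_on_sol_radial_v[OF z])
  have zero: "\<exists>x. 0 \<le> x \<and> x \<le> q \<and> ?v x = 0" if "0 \<le> q" "?v q \<le> 0" for q
    using IVT2'[of ?v q 0 0] that vc by auto
  define S where "S = {x \<in> {0..R}. ?v x = 0}"
  have "closed S" unfolding S_def by (intro continuous_closed_preimage_constant vc) auto
  moreover have "S \<noteq> {}"
  proof -
    obtain x where "0 \<le> x" "x \<le> r" "?v x = 0" using zero[of r] neg r by auto
    then have "x \<in> S" using r by (simp add: S_def)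
    then show ?thesis by blast
  qed
  moreover have bdd: "bdd_below S" by (auto simp: S_def)
  ultimately have "Inf S \<in> S" by (intro closed_contains_Inf)
  define q where "q = Inf S"
  have q: "0 \<le> q" "q \<le> R" "?v q = 0" using \<open>Inf S \<in> S\<close> by (auto simp: q_def S_def)
  have q0: "q > 0" using q by (cases "q = 0") auto
  have pos: "?v x > 0" if x: "0 \<le> x" "x < q" for x
  proof (rule ccontr)
    assume "\<not> ?v x > 0"
    then obtain y where "0 \<le> y" "y \<le> x" "?v y = 0" using zero[of x] x by auto
    then have "y \<in> S" using x q by (auto simp: S_def)
    then have "q \<le> y" unfolding q_def by (rule cInf_lower[OF _ bdd])
    with \<open>y \<le> x\<close> x show False by simp
  qed
  show False
  \<comment> \<open>For negative c the dilation would raise the eigenvalue instead of lowering it.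
    In this case v never falls below its initial value 1.\<close>
  proof (cases "c \<le> 0")
    case True
    have "?v q \<ge> 1"
      by (rule radial_v_ge_initial[OF z _ _ q(1)]) (auto intro!: continuous_intros simp: True mult_nonpos_nonneg)
    with q show False by simp
  next
    case False
    define \<beta> where "\<beta> = q / R"
    have \<beta>: "0 < \<beta>" "\<beta> \<le> 1" using q q0 R by (auto simp: \<beta>_def)
    define F where "F = (\<lambda>t. \<beta>\<^sup>2 * (c * max t 0))"
    define y where "y = (\<lambda>r. \<beta>\<^sup>2 * z (\<beta> * r))"
    have y: "sol F 1 y" using sol_scale(1)[OF z, of 1 \<beta>] by (simp add: F_def y_def)
    have yv: "radial_v 1 y r = ?v (\<beta> * r)" for r using sol_scale(2)[OF z, of 1 \<beta>] by (simp add: y_def)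
    have Fc: "continuous_on UNIV F" unfolding F_def by (intro continuous_intros)
    note pde = radial_solution_pde[OF y Fc n op]
    let ?\<phi> = "\<lambda>x :: real ^ 'n. radial_v 1 y (norm x)"
    have \<phi>pos: "?\<phi> x > 0" if "x \<in> ball 0 R" for x
    proof -
      have "\<beta> * norm x < \<beta> * R" using that \<beta> by simp
      also have "\<dots> = q" using R by (simp add: \<beta>_def)
      finally show ?thesis unfolding yv using \<beta> by (intro pos) auto
    qed
    have "has_positive_eigenfunction TYPE('n) s lam Lam R (\<beta>\<^sup>2 * c)"
      unfolding has_positive_eigenfunction_def
    proof (intro exI[of _ ?\<phi>] conjI ballI)
      show "C2_on (ball 0 R) ?\<phi>"
        using pde(1) unfolding C2_on_def
        by (meson continuous_on_subset differentiable_on_subset subset_UNIV)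
      show "continuous_on (cball 0 R) ?\<phi>"
        by (rule continuous_on_compose2[OF continuous_on_sol_radial_v[OF y, of UNIV] continuous_on_norm_id]) auto
      show "?\<phi> x > 0" if "x \<in> ball 0 R" for x using \<phi>pos[OF that] .
      show "pucci s lam Lam (hessian ?\<phi> x) + \<beta>\<^sup>2 * c * ?\<phi> x = 0" if "x \<in> ball 0 R" for x
        using \<phi>pos[OF that] unfolding pde(2) by (simp add: F_def)
      show "?\<phi> x = 0" if "x \<in> sphere 0 R" for x
        using that R q by (simp add: yv \<beta>_def)
    qed
    then have "\<beta>\<^sup>2 * c = \<mu>" using ev unfolding is_first_eigenvalue_def by blast
    moreover have "\<beta>\<^sup>2 * c \<le> 1 * c" using \<beta> False by (intro mult_right_mono) (auto simp: power_le_one)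
    ultimately show False using c by simp
  qed
qed

text \<open>A solution that stays nonnegative also stays below its initial value 1 \<le> M, so the
  clipping is invisible. Dilation by 1 / sqrt C normalises the coefficient and yields a nontrivial
  entire radial solution, which p < pc excludes.\<close>

lemma power_solution_sign_change:
  assumes crit: "is_critical_exponent TYPE('n::finite) s lam Lam pc" and p: "1 < p" "p < pc"
    and n: "CARD('n) \<ge> 2" "\<nu> = real CARD('n) - 1"
    and op: "a = upper_slope s lam Lam" "b = lower_slope s lam Lam"
    and C: "C > 0" and M: "M \<ge> 1" and z: "sol (\<lambda>t. C * clip M t powr p) 1 z"
  shows "\<exists>r\<ge>0. radial_v 1 z r < 0"
proof (rule ccontr)
  assume "\<not> (\<exists>r\<ge>0. radial_v 1 z r < 0)"
  then have nonneg: "radial_v 1 z r \<ge> 0" if "r \<ge> 0" for r using that by force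
  have lip: "(p * M powr (p - 1))-lipschitz_on UNIV (\<lambda>t. clip M t powr p)"
    using M by (intro lipschitz_clip lipschitz_powr p(1)) auto
  have pc: "continuous_on UNIV (\<lambda>t. clip M t powr p)"
    using lip by (rule lipschitz_on_continuous_on)
  have le: "radial_v 1 z r \<le> 1" if "r \<ge> 0" for r
    by (rule radial_v_le_initial[OF z _ _ that]) (use C in \<open>auto intro!: continuous_on_mult continuous_on_const pc\<close>)
  define \<beta> where "\<beta> = 1 / sqrt C"
  have \<beta>: "\<beta> > 0" "\<beta>\<^sup>2 * C = 1" using C by (auto simp: \<beta>_def power_divide)
  define F where "F = (\<lambda>t. clip M t powr p)"
  define y where "y = (\<lambda>r. \<beta>\<^sup>2 * z (\<beta> * r))"
  have y: "sol F 1 y"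
    using sol_scale(1)[OF z, of 1 \<beta>] \<beta>(2) by (simp add: F_def y_def flip: mult.assoc)
  have yv: "radial_v 1 y r = radial_v 1 z (\<beta> * r)" for r using sol_scale(2)[OF z, of 1 \<beta>] by (simp add: y_def)
  note pde = radial_solution_pde[OF y pc[folded F_def] n op]
  let ?\<phi> = "\<lambda>x :: real ^ 'n. radial_v 1 y (norm x)"
  have range: "?\<phi> x \<in> {0..M}" for x
    using nonneg[of "\<beta> * norm x"] le[of "\<beta> * norm x"] \<beta> M by (simp add: yv)
  have "entire_radial_solution s lam Lam p ?\<phi>"
    unfolding entire_radial_solution_def
  proof (intro conjI allI)
    show "radial_on UNIV ?\<phi>" unfolding radial_on_def by blast
    show "?\<phi> x \<ge> 0" for x using range by simp
    show "pucci s lam Lam (hessian ?\<phi> x) + ?\<phi> x powr p = 0" for x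
      unfolding pde(2) by (simp add: F_def clip_id[OF range])
  qed (rule pde(1))
  moreover have "?\<phi> 0 \<noteq> 0" by simp
  ultimately show False using crit p unfolding is_critical_exponent_def by blast
qed

end

section \<open>The change of variable and its inverse\<close>

lemma deriv_integral_halfline:
  fixes f :: "real \<Rightarrow> real"
  assumes "continuous_on {0..} f" "t > 0"
  shows "((\<lambda>x. integral {0..x} f) has_real_derivative f t) (at t)"
proof -
  have "((\<lambda>x. integral {0..x} f) has_real_derivative f t) (at t within {0..t + 1})"
    using assms by (intro integral_has_real_derivative continuous_on_subset[OF assms(1)]) auto
  then show ?thesis using assms by (simp add: at_within_Icc_at)
qed

lemma continuous_on_integral_halfline:
  fixes f :: "real \<Rightarrow> real"
  assumes "continuous_on {0..} f"
  shows "continuous_on {0..} (\<lambda>x. integral {0..x} f)"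
proof -
  have "continuous (at t within {0..}) (\<lambda>x. integral {0..x} f)" if t: "t \<ge> 0" for t
  proof -
    have "((\<lambda>x. integral {0..x} f) has_real_derivative f t) (at t within {0..t + 1})"
      using t by (intro integral_has_real_derivative continuous_on_subset[OF assms]) auto
    then have "continuous (at t within {0..t + 1}) (\<lambda>x. integral {0..x} f)"
      by (rule DERIV_continuous)
    moreover have "at t within {0..t + 1} = at t within {0..}"
      using t by (intro at_within_nhd[of _ "{..<t + 1}"]) auto
    ultimately show ?thesis by simp
  qed
  then show ?thesis by (simp add: continuous_on_eq_continuous_within)
qed

locale phi_function =
  fixes g :: "real \<Rightarrow> real"
  assumes g_cont: "continuous_on {0..} g" and g_nonneg: "\<And>t. t \<ge> 0 \<Longrightarrow> g t \<ge> 0"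
begin

lemma primitive_cont: "continuous_on {0..} (primitive g)"
  unfolding primitive_def by (rule continuous_on_integral_halfline[OF g_cont])

lemma primitive_deriv: "t > 0 \<Longrightarrow> (primitive g has_real_derivative g t) (at t)"
  unfolding primitive_def by (rule deriv_integral_halfline[OF g_cont])

lemma primitive_nonneg: "t \<ge> 0 \<Longrightarrow> primitive g t \<ge> 0"
  unfolding primitive_def
  by (intro integral_nonneg integrable_continuous_interval continuous_on_subset[OF g_cont]) (auto intro: g_nonneg)

lemma exp_primitive_cont: "continuous_on {0..} (\<lambda>t. exp (primitive g t))"
  by (intro continuous_intros primitive_cont)

lemma phi_cont: "continuous_on {0..} (phi g)"
  unfolding phi_def by (rule continuous_on_integral_halfline[OF exp_primitive_cont])

lemma phi_deriv: "t > 0 \<Longrightarrow> (phi g has_real_derivative exp (primitive g t)) (at t)"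
  unfolding phi_def by (rule deriv_integral_halfline[OF exp_primitive_cont])

lemma phi_0 [simp]: "phi g 0 = 0"
  by (simp add: phi_def)

text \<open>The derivative of \<open>phi g\<close> is exp(G) \<ge> 1 because g \<ge> 0. Injectivity,
  surjectivity onto the half-line and the Lipschitz bound for the inverse all follow from this
  expansion.\<close>

lemma phi_expanding:
  assumes "0 \<le> s" "s \<le> t"
  shows "t - s \<le> phi g t - phi g s"
proof -
  have "phi g s - s \<le> phi g t - t"
  proof (rule DERIV_nonneg_imp_increasing_open[OF assms(2)])
    fix x assume x: "s < x" "x < t"
    have "((\<lambda>x. phi g x - x) has_real_derivative exp (primitive g x) - 1) (at x)"
      using x assms by (intro derivative_intros phi_deriv) auto
    moreover have "exp (primitive g x) - 1 \<ge> 0" using primitive_nonneg[of x] x assms by simp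
    ultimately show "\<exists>y. ((\<lambda>x. phi g x - x) has_real_derivative y) (at x) \<and> 0 \<le> y" by blast
  qed (use assms in \<open>auto intro!: continuous_intros continuous_on_subset[OF phi_cont]\<close>)
  then show ?thesis by simp
qed

lemma phi_less: "\<lbrakk>0 \<le> s; s < t\<rbrakk> \<Longrightarrow> phi g s < phi g t"
  using phi_expanding[of s t] by simp

lemma phi_ge: "0 \<le> t \<Longrightarrow> t \<le> phi g t"
  using phi_expanding[of 0 t] by simp

lemma bij_phi: "bij_betw (phi g) {0..} {0..}"
proof (rule bij_betw_imageI)
  show "inj_on (phi g) {0..}"
    by (rule linorder_inj_onI) (auto dest: phi_less)
  show "phi g ` {0..} = {0..}"
  proof
    show "phi g ` {0..} \<subseteq> {0..}" by (auto intro: order_trans[OF _ phi_ge])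
    show "{0..} \<subseteq> phi g ` {0..}"
    proof
      fix y :: real assume "y \<in> {0..}"
      then have "\<exists>x. 0 \<le> x \<and> x \<le> y \<and> phi g x = y"
        using phi_ge[of y] by (intro IVT' continuous_on_subset[OF phi_cont]) auto
      then show "y \<in> phi g ` {0..}" by auto
    qed
  qed
qed

lemma phi_phi_inv: "s \<ge> 0 \<Longrightarrow> phi g (phi_inv g s) = s"
  unfolding phi_inv_def using bij_phi by (intro f_the_inv_into_f_bij_betw[OF bij_phi]) auto

lemma phi_inv_phi: "t \<ge> 0 \<Longrightarrow> phi_inv g (phi g t) = t"
  unfolding phi_inv_def using bij_phi by (intro the_inv_into_f_f) (auto simp: bij_betw_def)

lemma phi_inv_nonneg: "s \<ge> 0 \<Longrightarrow> phi_inv g s \<ge> 0"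
  using bij_betw_the_inv_into[OF bij_phi] unfolding phi_inv_def bij_betw_def by auto

lemma phi_inv_0 [simp]: "phi_inv g 0 = 0"
  using phi_inv_phi[of 0] by simp

lemma phi_inv_pos: "s > 0 \<Longrightarrow> phi_inv g s > 0"
  using phi_inv_nonneg[of s] phi_phi_inv[of s] by (cases "phi_inv g s = 0") auto

lemma phi_inv_lipschitz: "1-lipschitz_on {0..} (phi_inv g)"
proof (rule lipschitz_onI)
  fix s t :: real assume "s \<in> {0..}" "t \<in> {0..}"
  then show "dist (phi_inv g s) (phi_inv g t) \<le> 1 * dist s t"
    using phi_expanding[of "phi_inv g s" "phi_inv g t"] phi_expanding[of "phi_inv g t" "phi_inv g s"]
      phi_inv_nonneg phi_phi_inv
    by (cases "phi_inv g s \<le> phi_inv g t") (auto simp: dist_real_def)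
qed simp

lemma phi_inv_cont: "continuous_on {0..} (phi_inv g)"
  using phi_inv_lipschitz by (rule lipschitz_on_continuous_on)

lemma phi_inv_deriv:
  assumes "s > 0"
  shows "(phi_inv g has_real_derivative exp (- primitive g (phi_inv g s))) (at s)"
proof -
  have "continuous_on {0<..} (phi_inv g)" by (rule continuous_on_subset[OF phi_inv_cont]) auto
  then have cont: "isCont (phi_inv g) s" using assms by (simp add: continuous_on_eq_continuous_at)
  have "(phi_inv g has_real_derivative inverse (exp (primitive g (phi_inv g s)))) (at s)"
    by (rule DERIV_inverse_function[where f = "phi g" and g = "phi_inv g" and x = s and a = 0 and b = "s + 1", OF phi_deriv[OF phi_inv_pos[OF assms]]])
      (use assms phi_phi_inv cont in auto)
  then show ?thesis by (simp add: exp_minus)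
qed

lemma phi_inv_at_top: "filterlim (phi_inv g) at_top at_top"
  unfolding filterlim_at_top
proof
  fix Z :: real
  have "Z \<le> phi_inv g t" if t: "t \<ge> max 0 (phi g (max 0 Z))" for t
  proof (rule ccontr)
    assume "\<not> Z \<le> phi_inv g t"
    then have "phi g (phi_inv g t) < phi g (max 0 Z)" using phi_inv_nonneg[of t] t by (intro phi_less) auto
    then show False using phi_phi_inv[of t] t by simp
  qed
  then show "\<forall>\<^sub>F t in at_top. Z \<le> phi_inv g t"
    unfolding eventually_at_top_linorder by blast
qed

lemma phi_inv_at_right_0: "filterlim (phi_inv g) (at_right 0) (at_right 0)"
proof -
  have "(phi_inv g \<longlongrightarrow> phi_inv g 0) (at 0 within {0..})"
    using phi_inv_cont unfolding continuous_on_def by (rule bspec) simp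
  then have "(phi_inv g \<longlongrightarrow> phi_inv g 0) (at_right 0)"
    by (rule tendsto_within_subset) auto
  moreover have "\<forall>\<^sub>F s in at_right 0. phi_inv g s \<in> {0<..} \<and> phi_inv g s \<noteq> 0"
    unfolding eventually_at_right_field using phi_inv_pos by (intro exI[of _ 1]) force
  ultimately show ?thesis by (simp add: filterlim_at)
qed

end

section \<open>Removing the gradient term\<close>

text \<open>The gradient is z x, so its tensor square alters only the eigenvalue along x, by k (|x|
  z)^2; this is the amount by which the substitution shifts the second derivative.\<close>

lemma radial_matrix_add_tensor_square:
  "radial_matrix z (w - k * (norm x * z)\<^sup>2) x + k *\<^sub>R tensor_square (z *\<^sub>R x) = radial_matrix z w x"
proof (cases "x = 0")
  case True
  then show ?thesis by (simp add: radial_matrix_def tensor_square_def vec_eq_iff)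
next
  case False
  then have "(w - k * (norm x * z)\<^sup>2 - z) / (norm x)\<^sup>2 + k * z\<^sup>2 = (w - z) / (norm x)\<^sup>2"
    by (simp add: field_simps)
  then show ?thesis
    unfolding radial_matrix_def tensor_square_scaleR scaleR_scaleR add.assoc scaleR_left_distrib[symmetric]
    by simp
qed

context phi_function begin

text \<open>The chain-rule factor 1 / \<phi>_g'(u) at u = \<open>phi_inv g (v r)\<close>.\<close>

definition weight :: "(real \<Rightarrow> real) \<Rightarrow> real \<Rightarrow> real" where
  "weight v r = exp (- primitive g (phi_inv g (v r)))"

text \<open>With E the weight, u' = E v' and E' = - g(u) u' E, hence u'' = E v'' - g(u) (u')^2. The
  last term is the one that the gradient term of the equation compensates.\<close>

lemma radial_profile_phi_inv:
  assumes prof: "radial_profile v z w R" and cont: "continuous_on {0..<R} v"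
    and pos: "\<And>r. \<lbrakk>0 \<le> r; r < R\<rbrakk> \<Longrightarrow> v r > 0" and R: "R > 0"
  shows "radial_profile (\<lambda>r. phi_inv g (v r)) (\<lambda>r. weight v r * z r)
    (\<lambda>r. weight v r * w r - g (phi_inv g (v r)) * (r * (weight v r * z r))\<^sup>2) R"
proof -
  interpret radial_profile v z w R by (rule prof)
  have pos': "v r \<ge> 0" if "0 \<le> r" "r < R" for r using pos[OF that] by simp
  have U: "((\<lambda>r. phi_inv g (v r)) has_real_derivative weight v r * d) (at r within S)"
    if "(v has_real_derivative d) (at r within S)" "0 \<le> r" "r < R" for r d S
    using DERIV_chain'[OF that(1) phi_inv_deriv[OF pos[OF that(2,3)]]] by (simp add: weight_def)
  have Uc: "continuous_on {0..<R} (\<lambda>r. phi_inv g (v r))"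
    by (rule continuous_on_compose2[OF phi_inv_cont cont]) (auto intro: pos')
  have nonneg: "(\<lambda>r. phi_inv g (v r)) ` {0..<R} \<subseteq> {0..}"
    by (intro image_subsetI) (simp add: phi_inv_nonneg pos')
  have Ec: "continuous_on {0..<R} (weight v)"
    unfolding weight_def by (intro continuous_intros continuous_on_compose2[OF primitive_cont Uc nonneg])
  have gc: "continuous_on {0..<R} (\<lambda>r. g (phi_inv g (v r)))"
    by (rule continuous_on_compose2[OF g_cont Uc nonneg])
  show ?thesis
  proof
    fix r assume r: "0 < r" "r < R"
    have dU: "((\<lambda>r. phi_inv g (v r)) has_real_derivative r * (weight v r * z r)) (at r)"
      using U[OF deriv_U[OF r]] r by (simp add: mult_ac)
    then show "((\<lambda>r. phi_inv g (v r)) has_real_derivative r * (weight v r * z r)) (at r)" .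
    have "(weight v has_real_derivative
        weight v r * - (g (phi_inv g (v r)) * (r * (weight v r * z r)))) (at r)"
      unfolding weight_def[of v, abs_def]
      using DERIV_chain'[OF dU primitive_deriv[OF phi_inv_pos[OF pos]]] r
      by (intro DERIV_chain'[OF DERIV_minus DERIV_exp]) (auto simp: weight_def)
    from DERIV_mult[OF this deriv_Z[OF r]]
    have "((\<lambda>r. weight v r * (r * z r)) has_real_derivative
        weight v r * - (g (phi_inv g (v r)) * (r * (weight v r * z r))) * (r * z r) + w r * weight v r) (at r)" .
    moreover have "(\<lambda>r. weight v r * (r * z r)) = (\<lambda>r. r * (weight v r * z r))"
      by (simp add: mult_ac)
    moreover have "weight v r * - (g (phi_inv g (v r)) * (r * (weight v r * z r))) * (r * z r) + w r * weight v r
        = weight v r * w r - g (phi_inv g (v r)) * (r * (weight v r * z r))\<^sup>2"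
      by (simp add: power2_eq_square algebra_simps)
    ultimately show "((\<lambda>r. r * (weight v r * z r)) has_real_derivative
        weight v r * w r - g (phi_inv g (v r)) * (r * (weight v r * z r))\<^sup>2) (at r)" by (simp only:)
  next
    show "((\<lambda>r. phi_inv g (v r)) has_real_derivative 0) (at 0 within {0..})"
      using U[OF deriv_U_0] R by simp
    show "continuous_on {0..<R} (\<lambda>r. weight v r * z r)" by (intro continuous_intros Ec cont_Z)
    show "continuous_on {0..<R} (\<lambda>r. weight v r * w r - g (phi_inv g (v r)) * (r * (weight v r * z r))\<^sup>2)"
      by (intro continuous_intros Ec cont_Z cont_W gc)
  qed (simp add: W_0)
qed

definition transformed :: "real \<Rightarrow> (real \<Rightarrow> real) \<Rightarrow> real \<Rightarrow> real" where
  "transformed \<gamma> \<psi> t = exp (primitive g (phi_inv g t)) * \<psi> (phi_inv g t) - \<gamma> * t"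

lemma transformed_ge:
  assumes "\<And>t. t \<ge> 0 \<Longrightarrow> \<psi> t \<ge> 0" "t \<ge> 0"
  shows "- \<gamma> * t \<le> transformed \<gamma> \<psi> t"
  using assms(1)[OF phi_inv_nonneg[OF assms(2)]] by (simp add: transformed_def)

lemma transformed_lipschitz:
  assumes "locally_lipschitz_on {0..} (\<lambda>t. exp (primitive g (phi_inv g t)) * \<psi> (phi_inv g t))"
  shows "\<exists>L. L-lipschitz_on {0..K} (transformed \<gamma> \<psi>)"
proof -
  let ?h = "\<lambda>t. exp (primitive g (phi_inv g t)) * \<psi> (phi_inv g t)"
  have "local_lipschitz UNIV {0..} (\<lambda>_ :: real. ?h)" using assms by (simp add: locally_lipschitz_on_def)
  then have "local_lipschitz {0 :: real} {0..K} (\<lambda>_. ?h)" by (rule local_lipschitz_subset) auto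
  then obtain L where "L-lipschitz_on {0..K} ?h"
    by (rule local_lipschitz_compact_implies_lipschitz) (auto intro: continuous_on_const)
  moreover have "(\<bar>\<gamma>\<bar> * 1)-lipschitz_on {0..K} (\<lambda>t. \<gamma> * t)"
    by (intro lipschitz_on_cmult_real) (simp add: lipschitz_on_def)
  ultimately have "(L + \<bar>\<gamma>\<bar> * 1)-lipschitz_on {0..K} (\<lambda>t. ?h t - \<gamma> * t)" by (rule lipschitz_on_diff)
  then show ?thesis by (auto simp: transformed_def[abs_def])
qed

lemma transformed_lim_0:
  assumes "((\<lambda>t. exp (primitive g t) * \<psi> t / phi g t) \<longlongrightarrow> c) (at_right 0)"
  shows "((\<lambda>t. transformed \<gamma> \<psi> t / t) \<longlongrightarrow> c - \<gamma>) (at_right 0)"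
proof (rule Lim_transform_eventually[OF tendsto_diff[OF filterlim_compose[OF assms phi_inv_at_right_0] tendsto_const]])
  show "\<forall>\<^sub>F t in at_right 0. exp (primitive g (phi_inv g t)) * \<psi> (phi_inv g t) / phi g (phi_inv g t) - \<gamma>
      = transformed \<gamma> \<psi> t / t"
    unfolding eventually_at_right_field
    by (intro exI[of _ 1]) (auto simp: phi_phi_inv transformed_def diff_divide_distrib)
qed

lemma transformed_lim_at_top:
  assumes "((\<lambda>t. exp (primitive g t) * \<psi> t / phi g t powr p) \<longlongrightarrow> C) at_top" and p: "p > 1"
  shows "((\<lambda>t. transformed \<gamma> \<psi> t / t powr p) \<longlongrightarrow> C) at_top"
proof -
  have "((\<lambda>t. \<gamma> * t powr (1 - p)) \<longlongrightarrow> \<gamma> * 0) at_top"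
    using p by (intro tendsto_intros tendsto_neg_powr filterlim_ident) auto
  with filterlim_compose[OF assms(1) phi_inv_at_top]
  have "((\<lambda>t. exp (primitive g (phi_inv g t)) * \<psi> (phi_inv g t) / phi g (phi_inv g t) powr p
      - \<gamma> * t powr (1 - p)) \<longlongrightarrow> C - \<gamma> * 0) at_top" by (rule tendsto_diff)
  moreover have "\<forall>\<^sub>F t in at_top. exp (primitive g (phi_inv g t)) * \<psi> (phi_inv g t) / phi g (phi_inv g t) powr p
      - \<gamma> * t powr (1 - p) = transformed \<gamma> \<psi> t / t powr p"
    using eventually_gt_at_top[of 0]
    by eventually_elim (simp add: phi_phi_inv transformed_def diff_divide_distrib powr_diff)
  ultimately show ?thesis by (auto intro: Lim_transform_eventually)
qed

text \<open>A finite limit of F(t) / t forces F(t) to tend to 0, and continuity identifies the limit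
  with F(0).\<close>

lemma transformed_0:
  assumes lim: "((\<lambda>t. transformed \<gamma> \<psi> t / t) \<longlongrightarrow> c) (at_right 0)"
    and lip: "L-lipschitz_on {0..1} (transformed \<gamma> \<psi>)"
  shows "transformed \<gamma> \<psi> 0 = 0"
proof -
  have "((\<lambda>t. transformed \<gamma> \<psi> t / t * t) \<longlongrightarrow> c * 0) (at_right 0)"
    by (intro tendsto_mult lim tendsto_ident_at)
  moreover have "\<forall>\<^sub>F t in at_right 0. transformed \<gamma> \<psi> t / t * t = transformed \<gamma> \<psi> t"
    unfolding eventually_at_right_field by (intro exI[of _ 1]) auto
  ultimately have "(transformed \<gamma> \<psi> \<longlongrightarrow> 0) (at_right 0)"
    by (auto intro: Lim_transform_eventually)
  moreover have "continuous_on {0..1} (transformed \<gamma> \<psi>)" using lip by (rule lipschitz_on_continuous_on)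
  then have "(transformed \<gamma> \<psi> \<longlongrightarrow> transformed \<gamma> \<psi> 0) (at 0 within {0..1})"
    by (auto simp: continuous_on_def)
  then have "(transformed \<gamma> \<psi> \<longlongrightarrow> transformed \<gamma> \<psi> 0) (at_right 0)"
    by (simp add: at_within_Icc_at_right)
  ultimately show ?thesis by (intro tendsto_unique[OF trivial_limit_at_right_real])
qed

end

section \<open>Assembly of the solution in the ball\<close>

theorem theorem1p12:
  fixes lam Lam R pc \<mu>1 \<gamma> p Cstar cstar :: real
    and s :: pucci_sign
    and f g \<psi> :: "real \<Rightarrow> real"
  assumes "CARD('n::finite) \<ge> 3"
    and "0 < lam" and "lam \<le> Lam" and "0 < R"
    and "s = Plus_Op \<Longrightarrow> lam / Lam * (real CARD('n) - 1) + 1 > 2"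
    and "is_critical_exponent TYPE('n) s lam Lam pc"
    and "is_first_eigenvalue TYPE('n) s lam Lam R \<mu>1"
    and "continuous_on {0..} g" and "\<And>t. t \<ge> 0 \<Longrightarrow> g t \<ge> 0"
    and "\<gamma> \<ge> 0"
    and "\<And>t. t \<ge> 0 \<Longrightarrow> \<psi> t \<ge> 0"
    and "\<And>t. t \<ge> 0 \<Longrightarrow> f t = - \<gamma> * phi g t * exp (- primitive g t) + \<psi> t"
    and psi0: "continuous_on {0..} \<psi>"
      "locally_lipschitz_on {0..} (\<lambda>t. exp (primitive g (phi_inv g t)) * \<psi> (phi_inv g t))"
    and psi1: "1 < p" "p < pc" "Cstar > 0"
      "((\<lambda>t. exp (primitive g t) * \<psi> t / phi g t powr p) \<longlongrightarrow> Cstar) at_top"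
    and psi2: "cstar \<ge> 0" "cstar - \<gamma> < \<mu>1"
      "((\<lambda>t. exp (primitive g t) * \<psi> t / phi g t) \<longlongrightarrow> cstar) (at_right 0)"
  shows "\<exists>u :: real ^ 'n \<Rightarrow> real.
      C2_on (ball 0 R) u \<and> continuous_on (cball 0 R) u \<and> radial_on (cball 0 R) u \<and>
      (\<forall>x\<in>ball 0 R. u x > 0) \<and>
      (\<forall>x\<in>ball 0 R.
         pucci s lam Lam (hessian u x + g (u x) *\<^sub>R tensor_square (gradient u x)) + f (u x) = 0) \<and>
      (\<forall>x\<in>sphere 0 R. u x = 0)"
proof -
  interpret phi_function g by unfold_locales (use assms in auto)
  define a b where "a = upper_slope s lam Lam" and "b = lower_slope s lam Lam"
  define \<nu> where "\<nu> = real CARD('n) - 1"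
  have ab: "a > 0" "b > 0" using assms(2,3) by (auto simp: a_def b_def upper_slope_def lower_slope_def split: pucci_sign.split)
  have n: "CARD('n) \<ge> 2" using assms(1) by simp
  then have "\<nu> \<ge> 0" by (simp add: \<nu>_def)
  \<comment> \<open>The least natural number above the Lipschitz bound for \<open>H\<close>; for lam
    = Lam it equals n - 1.\<close>
  then interpret radial_pucci a b \<nu> "nat \<lceil>\<nu> * (max a b / min a b)\<rceil>"
    using ab by unfold_locales (auto intro: real_nat_ceiling_ge)
  let ?F = "transformed \<gamma> \<psi>"
  have lip: "\<exists>L. L-lipschitz_on {0..K} ?F" for K by (rule transformed_lipschitz[OF psi0(2)])
  have lim0: "((\<lambda>t. ?F t / t) \<longlongrightarrow> cstar - \<gamma>) (at_right 0)" by (rule transformed_lim_0[OF psi2(3)])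
  have lim: "((\<lambda>t. ?F t / t powr p) \<longlongrightarrow> Cstar) at_top" by (rule transformed_lim_at_top[OF psi1(4,1)])
  have F0: "?F 0 = 0" using transformed_0[OF lim0] lip by blast
  have ge: "?F t \<ge> - \<gamma> * t" if "t \<ge> 0" for t using transformed_ge[of \<psi>] assms(11) that by blast
  obtain K \<alpha> z where K: "K > 0" "\<alpha> > 0" and Fc: "continuous_on UNIV (\<lambda>t. ?F (clip K t))"
    and z: "sol (\<lambda>t. ?F (clip K t)) \<alpha> z"
    and pos: "\<And>r. \<lbrakk>0 \<le> r; r < R\<rbrakk> \<Longrightarrow> radial_v \<alpha> z r > 0" and vR: "radial_v \<alpha> z R = 0"
    and vK: "\<And>r. r \<in> {0..R} \<Longrightarrow> radial_v \<alpha> z r \<le> K"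
    by (rule radial_positive_solution[OF assms(4) lip F0 assms(10) ge lim0 lim psi1(1)
          linear_solution_positive[OF assms(7) psi2(2) assms(4) n \<nu>_def a_def b_def]
          power_solution_sign_change[OF assms(6) psi1(1,2) n \<nu>_def a_def b_def psi1(3)]])
      (assumption+, rule that)
  let ?v = "radial_v \<alpha> z" and ?w = "radial_w (\<lambda>t. ?F (clip K t)) \<alpha> z"
  have vc: "continuous_on S ?v" for S by (rule continuous_on_sol_radial_v[OF z])
  \<comment> \<open>Inside the ball 0 < v \<le> K, so the truncated equation is the original
    one.\<close>
  have w: "m (?w r) + \<nu> * m (z r) = - ?F (?v r)" if "0 \<le> r" "r < R" for r
    using m_radial_w[of "\<lambda>t. ?F (clip K t)" \<alpha> z r] pos[OF that] vK[of r] that by (simp add: clip_id)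
  interpret radial_profile "\<lambda>r. phi_inv g (?v r)" "\<lambda>r. weight ?v r * z r"
    "\<lambda>r. weight ?v r * ?w r - g (phi_inv g (?v r)) * (r * (weight ?v r * z r))\<^sup>2" R
    by (rule radial_profile_phi_inv[OF radial_profile_sol[OF z Fc] vc pos assms(4)])
  let ?u = "\<lambda>x :: real ^ 'n. phi_inv g (?v (norm x))"
  show ?thesis
  proof (intro exI[of _ ?u] conjI ballI)
    show "C2_on (ball 0 R) ?u" by (rule C2_on_radial)
    have v0: "?v r \<ge> 0" if "0 \<le> r" "r \<le> R" for r
      using pos[of r] vR that by (cases "r = R") auto
    have "continuous_on (cball 0 R) (\<lambda>x :: real ^ 'n. ?v (norm x))"
      by (rule continuous_on_compose2[OF vc continuous_on_norm_id subset_UNIV])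
    then show "continuous_on (cball 0 R) ?u"
      by (rule continuous_on_compose2[OF phi_inv_cont]) (auto intro: v0)
    show "radial_on (cball 0 R) ?u" unfolding radial_on_def by (rule exI[of _ "\<lambda>r. phi_inv g (?v r)"]) simp
    show "?u x > 0" if "x \<in> ball 0 R" for x using that by (intro phi_inv_pos pos) auto
    show "?u x = 0" if "x \<in> sphere 0 R" for x using that vR by simp
    fix x :: "real ^ 'n" assume "x \<in> ball 0 R"
    then have x: "norm x < R" by simp
    let ?r = "norm x"
    let ?E = "weight ?v ?r"
    have E: "?E > 0" by (simp add: weight_def)
    have "hessian ?u x + g (?u x) *\<^sub>R tensor_square (gradient ?u x) = radial_matrix (?E * z ?r) (?E * ?w ?r) x"
      unfolding hessian_radial[OF x] gradient_radial[OF x] by (rule radial_matrix_add_tensor_square)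
    then have "pucci s lam Lam (hessian ?u x + g (?u x) *\<^sub>R tensor_square (gradient ?u x))
        = m (?E * ?w ?r) + \<nu> * m (?E * z ?r)"
      using radial_w_0[OF z] by (simp add: pucci_radial_matrix n a_def b_def \<nu>_def)
    \<comment> \<open>The chain-rule factor is positive, so homogeneity pulls it out of the
      nonlinear operator.\<close>
    also have "\<dots> = ?E * (m (?w ?r) + \<nu> * m (z ?r))"
      unfolding two_slope_scale[OF less_imp_le[OF E]] by (simp add: algebra_simps)
    also have "\<dots> = - (?E * ?F (?v ?r))" using w[of ?r] x by simp
    \<comment> \<open>With t = \<phi>_g(u), the factor exp(- G(u)) turns F(t) = exp(G(u)) \<psi>(u)
      - \<gamma> t back into f(u).\<close>
    also have "?E * ?F (?v ?r) = f (?u x)"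
    proof -
      have "?v ?r \<ge> 0" using pos[of ?r] x by simp
      then show ?thesis
        using phi_inv_nonneg[of "?v ?r"] phi_phi_inv[of "?v ?r"] assms(12)[of "?u x"]
        by (simp add: transformed_def weight_def algebra_simps exp_minus)
    qed
    finally show "pucci s lam Lam (hessian ?u x + g (?u x) *\<^sub>R tensor_square (gradient ?u x)) + f (?u x) = 0"
      by simp
  qed
qed

end
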